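(* Let $M$ be a right coherent monoid and $I$ a non-empty set. Then the Brandt monoid $\mathcal{B}(M;I)^1$ over $M$ is also right coherent.
   Context: For a monoid $M$ and non-empty set $I$, the Brandt semigroup $\mathcal{B}(M;I)$ is the set $(I\times M\times I)\cup\{0\}$, where $0$ is a new symbol, with multiplication \[(i,a,j)(k,b,\ell)=\begin{cases}(i,ab,\ell)&\text{if }j=k,\\ 0&\text{if }j\neq k,\end{cases}\qquad 0(i,a,j)=(i,a,j)0=0\cdot0=0.\] The Brandt monoid $\mathcal{B}(M;I)^1$ is obtained from it by adjoining a new identity element $1$. Let $S$ be a monoid. A right $S$-act is a set $A$ with a map $A\times S\to A$, $(a,s)\mapsto as$, with $a1=a$ and $a(st)=(as)t$. The free right $S$-act on a set $X$ is $F_S(X)=X\times S$ with $(x,s)t=(x,st)$. A congruence on a right $S$-act is an equivalence relation preserved by the action; it is finitely generated if it is the smallest congruence containing some finite set of pairs. An act $A$ is finitely generated if $A=a_1S\cup\dots\cup a_nS$ for some $a_i\in A$, and finitely presented if it is isomorphic to $F_S(X)/\rho$ with $X$ finite and $\rho$ a finitely generated congruence. The empty set is allowed as a subact (and is finitely generated). The monoid $S$ is right coherent if every finitely generated subact of every finitely presented right $S$-act is finitely presented. *)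

theory Defs
  imports "HOL-Algebra.Group"
begin

section \<open>Brandt monoids\<close>

datatype ('i, 'm) brandt = Zero | Elt 'i 'm 'i

definition brandt_carrier :: "('m, 'k) monoid_scheme \<Rightarrow> 'i set \<Rightarrow> ('i, 'm) brandt set" where
  "brandt_carrier M I = {Elt i a j | i a j. i \<in> I \<and> a \<in> carrier M \<and> j \<in> I} \<union> {Zero}"

fun brandt_mult ::
  "('m, 'k) monoid_scheme \<Rightarrow> ('i, 'm) brandt \<Rightarrow> ('i, 'm) brandt \<Rightarrow> ('i, 'm) brandt" where
  "brandt_mult M (Elt i a j) (Elt k b l) = (if j = k then Elt i (a \<otimes>\<^bsub>M\<^esub> b) l else Zero)"
| "brandt_mult M Zero y = Zero"
| "brandt_mult M x Zero = Zero"

text \<open>Adjoining an identity \<^term>\<open>None\<close> to a semigroup. It is always new, even if the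
  semigroup already has an identity.\<close>

fun adjoin_mult :: "('a \<Rightarrow> 'a \<Rightarrow> 'a) \<Rightarrow> 'a option \<Rightarrow> 'a option \<Rightarrow> 'a option" where
  "adjoin_mult f None y = y"
| "adjoin_mult f x None = x"
| "adjoin_mult f (Some x) (Some y) = Some (f x y)"

definition adjoin_one :: "'a set \<Rightarrow> ('a \<Rightarrow> 'a \<Rightarrow> 'a) \<Rightarrow> 'a option monoid" where
  "adjoin_one A f = \<lparr>carrier = insert None (Some ` A), mult = adjoin_mult f, one = None\<rparr>"

definition brandt_monoid ::
  "('m, 'k) monoid_scheme \<Rightarrow> 'i set \<Rightarrow> ('i, 'm) brandt option monoid" where
  "brandt_monoid M I = adjoin_one (brandt_carrier M I) (brandt_mult M)"

lemma brandt_mult_Zero_right [simp]: "brandt_mult M x Zero = Zero"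
  by (cases x) auto

lemma brandt_mult_closed:
  assumes "monoid M" "x \<in> brandt_carrier M I" "y \<in> brandt_carrier M I"
  shows "brandt_mult M x y \<in> brandt_carrier M I"
proof -
  interpret monoid M by fact
  show ?thesis
    using assms(2,3) by (cases x; cases y) (auto simp: brandt_carrier_def)
qed

lemma brandt_mult_assoc:
  assumes "monoid M" "x \<in> brandt_carrier M I" "y \<in> brandt_carrier M I" "z \<in> brandt_carrier M I"
  shows "brandt_mult M (brandt_mult M x y) z = brandt_mult M x (brandt_mult M y z)"
proof -
  interpret monoid M by fact
  show ?thesis
    using assms(2-) by (cases x; cases y; cases z) (auto simp: brandt_carrier_def m_assoc)
qed

lemma monoid_adjoin_one:
  assumes "\<And>x y. x \<in> A \<Longrightarrow> y \<in> A \<Longrightarrow> f x y \<in> A"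
    and "\<And>x y z. x \<in> A \<Longrightarrow> y \<in> A \<Longrightarrow> z \<in> A \<Longrightarrow> f (f x y) z = f x (f y z)"
  shows "monoid (adjoin_one A f)"
proof -
  have [simp]: "adjoin_mult f x None = x" for x by (cases x) auto
  show ?thesis by (rule monoidI) (auto simp: adjoin_one_def assms)
qed

lemma monoid_brandt_monoid: "monoid M \<Longrightarrow> monoid (brandt_monoid M I)"
  unfolding brandt_monoid_def
  by (rule monoid_adjoin_one) (rule brandt_mult_closed brandt_mult_assoc; assumption)+


section \<open>Right acts\<close>

record ('s, 'a) act = "'a partial_object" +
  act :: "'a \<Rightarrow> 's \<Rightarrow> 'a"  (infixl \<open>\<cdot>\<index>\<close> 70)

locale right_act = monoid S for S :: "('s, 'k) monoid_scheme" (structure) +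
  fixes A :: "('s, 'a) act"
  assumes act_closed: "a \<in> carrier A \<Longrightarrow> s \<in> carrier S \<Longrightarrow> a \<cdot>\<^bsub>A\<^esub> s \<in> carrier A"
    and act_one: "a \<in> carrier A \<Longrightarrow> a \<cdot>\<^bsub>A\<^esub> \<one> = a"
    and act_assoc: "a \<in> carrier A \<Longrightarrow> s \<in> carrier S \<Longrightarrow> t \<in> carrier S \<Longrightarrow>
      a \<cdot>\<^bsub>A\<^esub> (s \<otimes> t) = (a \<cdot>\<^bsub>A\<^esub> s) \<cdot>\<^bsub>A\<^esub> t"

definition subact :: "('s, 'k) monoid_scheme \<Rightarrow> 'a set \<Rightarrow> ('s, 'a) act \<Rightarrow> bool" where
  "subact S B A \<longleftrightarrow> B \<subseteq> carrier A \<and> (\<forall>b\<in>B. \<forall>s\<in>carrier S. b \<cdot>\<^bsub>A\<^esub> s \<in> B)"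

definition act_iso :: "('s, 'k) monoid_scheme \<Rightarrow> ('s, 'a) act \<Rightarrow> ('s, 'b) act \<Rightarrow> ('a \<Rightarrow> 'b) set" where
  "act_iso S A B = {f. bij_betw f (carrier A) (carrier B) \<and>
     (\<forall>a\<in>carrier A. \<forall>s\<in>carrier S. f (a \<cdot>\<^bsub>A\<^esub> s) = f a \<cdot>\<^bsub>B\<^esub> s)}"

definition free_act :: "('s, 'k) monoid_scheme \<Rightarrow> 'x set \<Rightarrow> ('s, 'x \<times> 's) act" where
  "free_act S X = \<lparr>carrier = X \<times> carrier S, act = (\<lambda>(x, s) t. (x, s \<otimes>\<^bsub>S\<^esub> t))\<rparr>"

definition act_congruence :: "('s, 'k) monoid_scheme \<Rightarrow> ('s, 'a) act \<Rightarrow> 'a rel \<Rightarrow> bool" where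
  "act_congruence S A \<rho> \<longleftrightarrow> equiv (carrier A) \<rho> \<and>
     (\<forall>(a, b)\<in>\<rho>. \<forall>s\<in>carrier S. (a \<cdot>\<^bsub>A\<^esub> s, b \<cdot>\<^bsub>A\<^esub> s) \<in> \<rho>)"

definition fg_congruence :: "('s, 'k) monoid_scheme \<Rightarrow> ('s, 'a) act \<Rightarrow> 'a rel \<Rightarrow> bool" where
  "fg_congruence S A \<rho> \<longleftrightarrow> act_congruence S A \<rho> \<and>
     (\<exists>H. finite H \<and> H \<subseteq> \<rho> \<and> (\<forall>\<sigma>. act_congruence S A \<sigma> \<and> H \<subseteq> \<sigma> \<longrightarrow> \<rho> \<subseteq> \<sigma>))"

text \<open>For a congruence \<open>\<rho>\<close>, the union below is the single class of \<open>a \<cdot> s\<close>, for any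
  representative \<open>a\<close> of \<open>C\<close>.\<close>

definition quotient_act :: "('s, 'a) act \<Rightarrow> 'a rel \<Rightarrow> ('s, 'a set) act" where
  "quotient_act A \<rho> = \<lparr>carrier = carrier A // \<rho>, act = (\<lambda>C s. \<Union>a\<in>C. \<rho> `` {a \<cdot>\<^bsub>A\<^esub> s})\<rparr>"

definition fin_gen :: "('s, 'k) monoid_scheme \<Rightarrow> ('s, 'a) act \<Rightarrow> bool" where
  "fin_gen S A \<longleftrightarrow> (\<exists>F. finite F \<and> F \<subseteq> carrier A \<and>
     carrier A = (\<Union>a\<in>F. (\<lambda>s. a \<cdot>\<^bsub>A\<^esub> s) ` carrier S))"

text \<open>Finite generating sets \<open>X\<close> are taken, up to bijection, among the finite subsets of
  \<^typ>\<open>nat\<close>.\<close>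

definition fin_pres :: "('s, 'k) monoid_scheme \<Rightarrow> ('s, 'a) act \<Rightarrow> bool" where
  "fin_pres S A \<longleftrightarrow> (\<exists>(X :: nat set) \<rho> f. finite X \<and> fg_congruence S (free_act S X) \<rho> \<and>
     f \<in> act_iso S A (quotient_act (free_act S X) \<rho>))"

text \<open>A definition cannot quantify over all types of acts. Acts on the type
  \<^typ>\<open>(nat \<times> 's) set\<close> include all the quotients \<open>F\<^sub>S(X)/\<rho>\<close> and hence suffice; the lemma
  \<open>right_coherentD\<close> below gives the property for acts over an arbitrary type.\<close>

definition right_coherent :: "('s, 'k) monoid_scheme \<Rightarrow> bool" where
  "right_coherent S \<longleftrightarrow> (\<forall>(A :: ('s, (nat \<times> 's) set) act) B.
     right_act S A \<and> fin_pres S A \<and> subact S B A \<and> fin_gen S (A\<lparr>carrier := B\<rparr>) \<longrightarrow>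
     fin_pres S (A\<lparr>carrier := B\<rparr>))"

lemma right_act_iso:
  assumes "right_act S A" "f \<in> act_iso S A B"
  shows "right_act S B"
proof -
  interpret right_act S A by fact
  have im: "carrier B = f ` carrier A"
    and hom: "\<And>a s. a \<in> carrier A \<Longrightarrow> s \<in> carrier S \<Longrightarrow> f a \<cdot>\<^bsub>B\<^esub> s = f (a \<cdot>\<^bsub>A\<^esub> s)"
    using assms by (auto simp: act_iso_def bij_betw_def)
  show ?thesis
    by unfold_locales (auto simp: im hom act_closed act_one act_assoc)
qed

lemma fin_pres_iso:
  assumes "fin_pres S B" "f \<in> act_iso S A B"
  shows "fin_pres S A"
proof -
  obtain X \<rho> g where *: "finite (X :: nat set)" "fg_congruence S (free_act S X) \<rho>"
    "g \<in> act_iso S B (quotient_act (free_act S X) \<rho>)"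
    using assms by (auto simp: fin_pres_def)
  have "g \<circ> f \<in> act_iso S A (quotient_act (free_act S X) \<rho>)"
    using *(3) assms(2) bij_betwE[of f "carrier A" "carrier B"]
    by (auto simp: act_iso_def intro: bij_betw_trans)
  with * show ?thesis by (auto simp: fin_pres_def)
qed

lemma right_coherentD:
  fixes A :: "('s, 'a) act" and S :: "('s, 'k) monoid_scheme"
  assumes coh: "right_coherent S" and A: "right_act S A" and fp: "fin_pres S A"
    and sub: "subact S B A" and fg: "fin_gen S (A\<lparr>carrier := B\<rparr>)"
  shows "fin_pres S (A\<lparr>carrier := B\<rparr>)"
proof -
  interpret right_act S A by fact
  obtain X \<rho> f where X: "finite (X :: nat set)" "fg_congruence S (free_act S X) \<rho>"
    "f \<in> act_iso S A (quotient_act (free_act S X) \<rho>)"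
    using fp by (auto simp: fin_pres_def)
  define Q where "Q = quotient_act (free_act S X) \<rho>"
  have f: "f \<in> act_iso S A Q" using X(3) by (simp add: Q_def)
  have bij: "bij_betw f (carrier A) (carrier Q)"
    and hom: "\<And>a s. a \<in> carrier A \<Longrightarrow> s \<in> carrier S \<Longrightarrow> f a \<cdot>\<^bsub>Q\<^esub> s = f (a \<cdot>\<^bsub>A\<^esub> s)"
    using f by (auto simp: act_iso_def)
  have BA: "B \<subseteq> carrier A" and Bcl: "\<And>b s. b \<in> B \<Longrightarrow> s \<in> carrier S \<Longrightarrow> b \<cdot>\<^bsub>A\<^esub> s \<in> B"
    using sub by (auto simp: subact_def)
  have iso: "f \<in> act_iso S (A\<lparr>carrier := B\<rparr>) (Q\<lparr>carrier := f ` B\<rparr>)"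
    using bij BA hom by (auto simp: act_iso_def bij_betw_def intro: inj_on_subset)
  have "fin_pres S Q"
    using X by (auto simp: fin_pres_def act_iso_def Q_def intro!: exI[of _ X] exI[of _ \<rho>] exI[of _ id])
  moreover have "subact S (f ` B) Q"
    using BA Bcl hom bij by (auto simp: subact_def bij_betw_def subset_iff)
  moreover have "fin_gen S (Q\<lparr>carrier := f ` B\<rparr>)"
  proof -
    obtain F where F: "finite F" "F \<subseteq> B" "B = (\<Union>a\<in>F. (\<lambda>s. a \<cdot>\<^bsub>A\<^esub> s) ` carrier S)"
      using fg by (auto simp: fin_gen_def)
    have eq: "f ` B = (\<Union>a\<in>F. (\<lambda>s. f a \<cdot>\<^bsub>Q\<^esub> s) ` carrier S)"
    proof -
      have "f ` B = (\<Union>a\<in>F. (\<lambda>s. f (a \<cdot>\<^bsub>A\<^esub> s)) ` carrier S)"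
        by (subst F(3)) (simp add: image_UN image_image)
      also have "\<dots> = (\<Union>a\<in>F. (\<lambda>s. f a \<cdot>\<^bsub>Q\<^esub> s) ` carrier S)"
        using F(2) BA hom by (intro SUP_cong image_cong) auto
      finally show ?thesis .
    qed
    have "f ` F \<subseteq> f ` B" using F(2) by (rule image_mono)
    moreover have "f ` B = (\<Union>a\<in>f ` F. (\<lambda>s. a \<cdot>\<^bsub>Q\<^esub> s) ` carrier S)"
      by (subst eq) (simp add: image_image)
    ultimately have "finite (f ` F) \<and> f ` F \<subseteq> carrier (Q\<lparr>carrier := f ` B\<rparr>) \<and>
      carrier (Q\<lparr>carrier := f ` B\<rparr>) = (\<Union>a\<in>f ` F. (\<lambda>s. a \<cdot>\<^bsub>Q\<lparr>carrier := f ` B\<rparr>\<^esub> s) ` carrier S)"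
      using F(1) by simp
    thus ?thesis unfolding fin_gen_def by (rule exI)
  qed
  ultimately have "fin_pres S (Q\<lparr>carrier := f ` B\<rparr>)"
    using coh right_act_iso[OF A f] by (auto simp: right_coherent_def)
  thus ?thesis using iso by (rule fin_pres_iso)
qed

end

theory Submission
  imports Defs
begin

text \<open>Fix an index \<open>o\<close>. An act \<open>A\<close> over the Brandt monoid is governed by its zeros \<open>A 0\<close> and by the
  \<open>M\<close>-act \<open>A (o, 1, o)\<close>, into which every \<open>a\<close> maps by \<open>(i, 1, o)\<close> for each \<open>i\<close>. The
  finitely many relations of a presentation and the finitely many generators \<open>y\<close> of a subact mention
  only a finite set \<open>J\<close> of indices. For \<open>i\<close> in \<open>J\<close>, the relations between the elements \<open>x (i, m, o)\<close>
  form a finite presentation of an \<open>M\<close>-act \<open>P\<close>, except that some finitely generated subact of \<open>P\<close> is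
  collapsed into the zeros. The zeros must be kept apart from \<open>P\<close>, because the one-element \<open>M\<close>-act need
  not be finitely presented. Coherence of \<open>M\<close>, applied to the subact of \<open>P\<close> generated by the elements
  \<open>y (i, 1, o)\<close> together with the generators of the collapsed subact, yields finitely many relations.
  For \<open>i\<close> outside \<open>J\<close>, the only nontrivial relations are \<open>y (i, m, o) = y 0\<close> where \<open>y = y e\<close>
  for some \<open>e = 0\<close> or \<open>e = (r, 1, r)\<close>, and these follow from the single relation \<open>y = y e\<close>.\<close>

section \<open>Presentations of acts\<close>

text \<open>The homomorphism of acts from the free act on \<open>X\<close> to \<open>A\<close> that
  extends \<open>g\<close>.\<close>

definition ev :: "('s, 'a) act \<Rightarrow> ('x \<Rightarrow> 'a) \<Rightarrow> 'x \<times> 's \<Rightarrow> 'a" where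
  "ev A g p = g (fst p) \<cdot>\<^bsub>A\<^esub> snd p"

definition ev_ker :: "('s, 'k) monoid_scheme \<Rightarrow> ('s, 'a) act \<Rightarrow> 'x set \<Rightarrow> ('x \<Rightarrow> 'a) \<Rightarrow> ('x \<times> 's) rel" where
  "ev_ker S A X g = {(p, q). p \<in> X \<times> carrier S \<and> q \<in> X \<times> carrier S \<and> ev A g p = ev A g q}"

text \<open>Presentation relative to chosen generators of \<open>A\<close> itself, with no quotient
  in between. The index set may have any type, so that products such as \<open>X \<times> J\<close>
  and sums can serve. Generation of the kernel by \<open>H\<close> is expressed as minimality among
  congruences.\<close>

definition presents ::
  "('s, 'k) monoid_scheme \<Rightarrow> ('s, 'a) act \<Rightarrow> 'x set \<Rightarrow> ('x \<Rightarrow> 'a) \<Rightarrow> ('x \<times> 's) rel \<Rightarrow> bool" where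
  "presents S A X g H \<longleftrightarrow> g ` X \<subseteq> carrier A \<and> carrier A = ev A g ` (X \<times> carrier S) \<and>
     H \<subseteq> ev_ker S A X g \<and>
     (\<forall>\<sigma>. act_congruence S (free_act S X) \<sigma> \<and> H \<subseteq> \<sigma> \<longrightarrow> ev_ker S A X g \<subseteq> \<sigma>)"

section \<open>Evaluation maps and congruences of free acts\<close>

lemma ev_simp [simp]: "ev A g (x, s) = g x \<cdot>\<^bsub>A\<^esub> s"
  by (simp add: ev_def)

lemma ev_carrier_update [simp]: "ev (A\<lparr>carrier := B\<rparr>) g = ev A g"
  by (simp add: ev_def fun_eq_iff)

lemma ev_image: "ev A g ` (X \<times> T) = (\<Union>x\<in>X. (\<lambda>s. g x \<cdot>\<^bsub>A\<^esub> s) ` T)"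
  by (simp add: Sigma_def image_UN UNION_singleton_eq_range image_image)

lemma carrier_free_act [simp]: "carrier (free_act S X) = X \<times> carrier S"
  by (simp add: free_act_def)

lemma act_free_act [simp]: "(x, s) \<cdot>\<^bsub>free_act S X\<^esub> t = (x, s \<otimes>\<^bsub>S\<^esub> t)"
  by (simp add: free_act_def)

lemma right_act_free: "monoid S \<Longrightarrow> right_act S (free_act S X)"
  by (auto simp: right_act_def right_act_axioms_def monoid.m_assoc monoid.m_closed monoid.r_one)

lemma act_congruenceI:
  assumes "\<sigma> \<subseteq> carrier A \<times> carrier A"
    and "\<And>p. p \<in> carrier A \<Longrightarrow> (p, p) \<in> \<sigma>"
    and "\<And>p q. (p, q) \<in> \<sigma> \<Longrightarrow> (q, p) \<in> \<sigma>"
    and "\<And>p q r. (p, q) \<in> \<sigma> \<Longrightarrow> (q, r) \<in> \<sigma> \<Longrightarrow> (p, r) \<in> \<sigma>"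
    and "\<And>p q s. (p, q) \<in> \<sigma> \<Longrightarrow> s \<in> carrier S \<Longrightarrow> (p \<cdot>\<^bsub>A\<^esub> s, q \<cdot>\<^bsub>A\<^esub> s) \<in> \<sigma>"
  shows "act_congruence S A \<sigma>"
proof -
  have "equiv (carrier A) \<sigma>"
    using assms(1-4) by (intro equivI refl_onI symI transI; blast)
  thus ?thesis unfolding act_congruence_def using assms(5) by blast
qed

lemma
  assumes "act_congruence S A \<sigma>"
  shows act_congruence_subset: "\<sigma> \<subseteq> carrier A \<times> carrier A"
    and act_congruence_refl: "p \<in> carrier A \<Longrightarrow> (p, p) \<in> \<sigma>"
    and act_congruence_sym: "(p, q) \<in> \<sigma> \<Longrightarrow> (q, p) \<in> \<sigma>"
    and act_congruence_trans: "(p, q) \<in> \<sigma> \<Longrightarrow> (q, r) \<in> \<sigma> \<Longrightarrow> (p, r) \<in> \<sigma>"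
    and act_congruence_act: "(p, q) \<in> \<sigma> \<Longrightarrow> s \<in> carrier S \<Longrightarrow> (p \<cdot>\<^bsub>A\<^esub> s, q \<cdot>\<^bsub>A\<^esub> s) \<in> \<sigma>"
proof -
  note c = assms[unfolded act_congruence_def equiv_def]
  show "\<sigma> \<subseteq> carrier A \<times> carrier A" using c by blast
  show "p \<in> carrier A \<Longrightarrow> (p, p) \<in> \<sigma>" using c by (blast dest: refl_onD)
  show "(p, q) \<in> \<sigma> \<Longrightarrow> (q, p) \<in> \<sigma>" using c by (blast dest: symD)
  show "(p, q) \<in> \<sigma> \<Longrightarrow> (q, r) \<in> \<sigma> \<Longrightarrow> (p, r) \<in> \<sigma>" using c by (blast dest: transD)
  show "(p, q) \<in> \<sigma> \<Longrightarrow> s \<in> carrier S \<Longrightarrow> (p \<cdot>\<^bsub>A\<^esub> s, q \<cdot>\<^bsub>A\<^esub> s) \<in> \<sigma>" using c by blast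
qed

context right_act
begin

lemma ev_closed:
  assumes "g ` X \<subseteq> carrier A" "p \<in> X \<times> carrier S"
  shows "ev A g p \<in> carrier A"
  using assms by (auto simp: act_closed image_subset_iff)

lemma ev_act:
  assumes "g ` X \<subseteq> carrier A" "p \<in> X \<times> carrier S" "s \<in> carrier S"
  shows "ev A g (p \<cdot>\<^bsub>free_act S X\<^esub> s) = ev A g p \<cdot>\<^bsub>A\<^esub> s"
  using assms by (auto simp: act_assoc image_subset_iff)

lemma ev_ev:
  assumes "h ` Y \<subseteq> carrier A" "\<beta> ` X \<subseteq> Y \<times> carrier S" "p \<in> X \<times> carrier S"
  shows "ev A h (ev (free_act S Y) \<beta> p) = ev A (\<lambda>x. ev A h (\<beta> x)) p"
proof -
  obtain x s where p: "p = (x, s)" "x \<in> X" "s \<in> carrier S" using assms(3) by auto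
  have "ev A h (\<beta> x \<cdot>\<^bsub>free_act S Y\<^esub> s) = ev A h (\<beta> x) \<cdot>\<^bsub>A\<^esub> s"
    by (rule ev_act[OF assms(1)]) (use p assms(2) in auto)
  thus ?thesis by (simp add: p)
qed

text \<open>\<open>ev A g\<close> is a homomorphism, so congruences pull back along it. Pulling back
  equality gives the kernel; pulling back along a translation of words compares congruences over two
  generating sets.\<close>

lemma act_congruence_pullback:
  assumes "g ` X \<subseteq> carrier A" "act_congruence S A \<sigma>"
  shows "act_congruence S (free_act S X)
    {(p, q). p \<in> X \<times> carrier S \<and> q \<in> X \<times> carrier S \<and> (ev A g p, ev A g q) \<in> \<sigma>}"
proof -
  interpret F: right_act S "free_act S X" by (rule right_act_free) (rule monoid_axioms)
  show ?thesis
  proof (rule act_congruenceI)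
    fix p q r s
    let ?R = "{(p, q). p \<in> X \<times> carrier S \<and> q \<in> X \<times> carrier S \<and> (ev A g p, ev A g q) \<in> \<sigma>}"
    show "?R \<subseteq> carrier (free_act S X) \<times> carrier (free_act S X)" by auto
    show "(p, p) \<in> ?R" if "p \<in> carrier (free_act S X)"
      using that act_congruence_refl[OF assms(2) ev_closed[OF assms(1)]] by simp
    show "(q, p) \<in> ?R" if "(p, q) \<in> ?R"
      using that act_congruence_sym[OF assms(2)] by blast
    show "(p, r) \<in> ?R" if "(p, q) \<in> ?R" "(q, r) \<in> ?R"
      using that act_congruence_trans[OF assms(2)] by blast
    show "(p \<cdot>\<^bsub>free_act S X\<^esub> s, q \<cdot>\<^bsub>free_act S X\<^esub> s) \<in> ?R" if pq: "(p, q) \<in> ?R" and s: "s \<in> carrier S"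
    proof -
      have "p \<cdot>\<^bsub>free_act S X\<^esub> s \<in> X \<times> carrier S" "q \<cdot>\<^bsub>free_act S X\<^esub> s \<in> X \<times> carrier S"
        using pq s F.act_closed[of p s] F.act_closed[of q s] by auto
      moreover have "(ev A g p \<cdot>\<^bsub>A\<^esub> s, ev A g q \<cdot>\<^bsub>A\<^esub> s) \<in> \<sigma>"
        using pq act_congruence_act[OF assms(2) _ s] by blast
      ultimately show ?thesis
        using pq ev_act[OF assms(1) _ s, of p] ev_act[OF assms(1) _ s, of q] by simp
    qed
  qed
qed

lemma act_congruence_ev_ker:
  assumes "g ` X \<subseteq> carrier A"
  shows "act_congruence S (free_act S X) (ev_ker S A X g)"
proof -
  have "act_congruence S A (Id_on (carrier A))"
    by (rule act_congruenceI) (auto simp: act_closed)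
  from act_congruence_pullback[OF assms this]
  show ?thesis
    by (rule back_subst[of "act_congruence S (free_act S X)"])
       (use ev_closed[OF assms] in \<open>auto simp: ev_ker_def\<close>)
qed

end

section \<open>Presentations and change of generators\<close>

lemma presentsD:
  assumes "presents S A X g H"
  shows "g ` X \<subseteq> carrier A" "carrier A = ev A g ` (X \<times> carrier S)"
    "\<And>p q. (p, q) \<in> H \<Longrightarrow> p \<in> X \<times> carrier S \<and> q \<in> X \<times> carrier S \<and> ev A g p = ev A g q"
    "\<And>\<sigma> p q. act_congruence S (free_act S X) \<sigma> \<Longrightarrow> H \<subseteq> \<sigma> \<Longrightarrow> p \<in> X \<times> carrier S \<Longrightarrow>
      q \<in> X \<times> carrier S \<Longrightarrow> ev A g p = ev A g q \<Longrightarrow> (p, q) \<in> \<sigma>"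
proof -
  show "g ` X \<subseteq> carrier A" "carrier A = ev A g ` (X \<times> carrier S)"
    using assms unfolding presents_def by blast+
  fix p q
  show "(p, q) \<in> H \<Longrightarrow> p \<in> X \<times> carrier S \<and> q \<in> X \<times> carrier S \<and> ev A g p = ev A g q"
    using assms unfolding presents_def ev_ker_def by blast
  fix \<sigma>
  assume "act_congruence S (free_act S X) \<sigma>" "H \<subseteq> \<sigma>" "p \<in> X \<times> carrier S"
      "q \<in> X \<times> carrier S" "ev A g p = ev A g q"
  thus "(p, q) \<in> \<sigma>"
    using assms unfolding presents_def ev_ker_def by blast
qed

text \<open>Express each family of generators in terms of the other: the given relations, translated,
  and the equations between a generator and its double translation suffice.\<close>

lemma presents_change_generators:
  fixes S (structure)
  assumes A: "right_act S A" and pres: "presents S A X g H" and fin: "finite H" "finite Y"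
    and hY: "h ` Y \<subseteq> carrier A" and gen: "carrier A = ev A h ` (Y \<times> carrier S)"
  shows "\<exists>G. finite G \<and> presents S A Y h G"
proof -
  interpret right_act S A by (rule A)
  interpret FY: right_act S "free_act S Y" by (rule right_act_free) (rule monoid_axioms)
  interpret FX: right_act S "free_act S X" by (rule right_act_free) (rule monoid_axioms)
  note gX = presentsD(1)[OF pres] and genX = presentsD(2)[OF pres]
  have "\<exists>p. p \<in> X \<times> carrier S \<and> ev A g p = h y" if "y \<in> Y" for y
  proof -
    have "h y \<in> ev A g ` (X \<times> carrier S)" using that hY unfolding genX[symmetric] by blast
    thus ?thesis by (elim imageE) metis
  qed
  then obtain \<alpha> where \<alpha>: "\<And>y. y \<in> Y \<Longrightarrow> \<alpha> y \<in> X \<times> carrier S \<and> ev A g (\<alpha> y) = h y"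
    by metis
  have "\<exists>p. p \<in> Y \<times> carrier S \<and> ev A h p = g x" if "x \<in> X" for x
  proof -
    have "g x \<in> ev A h ` (Y \<times> carrier S)" using that gX unfolding gen[symmetric] by blast
    thus ?thesis by (elim imageE) metis
  qed
  then obtain \<beta> where \<beta>: "\<And>x. x \<in> X \<Longrightarrow> \<beta> x \<in> Y \<times> carrier S \<and> ev A h (\<beta> x) = g x"
    by metis
  define a where "a = ev (free_act S X) \<alpha>"
  define b where "b = ev (free_act S Y) \<beta>"
  have \<alpha>': "\<alpha> ` Y \<subseteq> X \<times> carrier S" using \<alpha> by blast
  have \<beta>': "\<beta> ` X \<subseteq> Y \<times> carrier S" using \<beta> by blast
  have a_cl: "a u \<in> X \<times> carrier S" if "u \<in> Y \<times> carrier S" for u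
    using FX.ev_closed[of \<alpha> Y u] that \<alpha>' by (simp add: a_def)
  have b_cl: "b u \<in> Y \<times> carrier S" if "u \<in> X \<times> carrier S" for u
    using FY.ev_closed[of \<beta> X u] that \<beta>' by (simp add: b_def)
  have ev_a: "ev A g (a u) = ev A h u" if "u \<in> Y \<times> carrier S" for u
    using ev_ev[OF gX \<alpha>' that] \<alpha> that by (auto simp: a_def)
  have ev_b: "ev A h (b u) = ev A g u" if "u \<in> X \<times> carrier S" for u
    using ev_ev[OF hY \<beta>' that] \<beta> that by (auto simp: b_def)
  define G where "G = (\<lambda>(p, q). (b p, b q)) ` H \<union> (\<lambda>y. ((y, \<one>), b (\<alpha> y))) ` Y"
  have "finite G" using fin by (simp add: G_def)
  moreover have "presents S A Y h G"
    unfolding presents_def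
  proof (intro conjI allI impI)
    show "G \<subseteq> ev_ker S A Y h"
    proof -
      have "(b p, b q) \<in> ev_ker S A Y h" if "(p, q) \<in> H" for p q
        using presentsD(3)[OF pres that] b_cl ev_b by (simp add: ev_ker_def)
      moreover have "((y, \<one>), b (\<alpha> y)) \<in> ev_ker S A Y h" if y: "y \<in> Y" for y
      proof -
        have "h y \<in> carrier A" using y hY by blast
        thus ?thesis
          using b_cl[of "\<alpha> y"] ev_b[of "\<alpha> y"] \<alpha>[OF y] y by (simp add: ev_ker_def act_one)
      qed
      ultimately show ?thesis unfolding G_def by (intro Un_least image_subsetI; clarify)
    qed
  next
    fix \<sigma> assume \<sigma>: "act_congruence S (free_act S Y) \<sigma> \<and> G \<subseteq> \<sigma>"
    \<comment> \<open>Minimality of \<open>H\<close> speaks only of congruences over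
      \<open>X\<close>, hence \<open>\<sigma>\<close> is moved there along \<open>b\<close>.\<close>
    define \<sigma>' where "\<sigma>' = {(p, q). p \<in> X \<times> carrier S \<and> q \<in> X \<times> carrier S \<and> (b p, b q) \<in> \<sigma>}"
    have \<sigma>'c: "act_congruence S (free_act S X) \<sigma>'"
      unfolding \<sigma>'_def b_def by (rule FY.act_congruence_pullback) (use \<beta>' \<sigma> in auto)
    have "H \<subseteq> \<sigma>'"
    proof (rule subrelI)
      fix p q assume pq: "(p, q) \<in> H"
      hence "(b p, b q) \<in> \<sigma>" using \<sigma> unfolding G_def by blast
      thus "(p, q) \<in> \<sigma>'" using presentsD(3)[OF pres pq] by (simp add: \<sigma>'_def)
    qed
    note min = presentsD(4)[OF pres \<sigma>'c this]
    \<comment> \<open>For a free generator this is the second family in \<open>G\<close>; acting by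
      \<open>s\<close> gives all words.\<close>
    have step: "(u, b (a u)) \<in> \<sigma>" if uY: "u \<in> Y \<times> carrier S" for u
    proof -
      obtain y s where u: "u = (y, s)" "y \<in> Y" "s \<in> carrier S" using uY by (rule SigmaE)
      have "((y, \<one>), b (\<alpha> y)) \<in> \<sigma>" using \<sigma> u by (auto simp: G_def)
      hence "((y, \<one>) \<cdot>\<^bsub>free_act S Y\<^esub> s, b (\<alpha> y) \<cdot>\<^bsub>free_act S Y\<^esub> s) \<in> \<sigma>"
        by (rule act_congruence_act[OF conjunct1[OF \<sigma>] _ u(3)])
      moreover have "b (\<alpha> y) \<cdot>\<^bsub>free_act S Y\<^esub> s = b (\<alpha> y \<cdot>\<^bsub>free_act S X\<^esub> s)"
        unfolding b_def by (rule FY.ev_act[symmetric]) (use \<beta>' \<alpha> u in auto)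
      ultimately show ?thesis using u by (simp add: a_def)
    qed
    show "ev_ker S A Y h \<subseteq> \<sigma>"
    proof (rule subrelI)
      fix u v assume "(u, v) \<in> ev_ker S A Y h"
      hence uv: "u \<in> Y \<times> carrier S" "v \<in> Y \<times> carrier S" "ev A h u = ev A h v"
        by (simp_all add: ev_ker_def)
      have "(a u, a v) \<in> \<sigma>'" using min uv a_cl ev_a by simp
      hence "(b (a u), b (a v)) \<in> \<sigma>" by (simp add: \<sigma>'_def)
      thus "(u, v) \<in> \<sigma>"
        using act_congruence_trans[OF conjunct1[OF \<sigma>] step[OF uv(1)]]
          act_congruence_trans[OF conjunct1[OF \<sigma>] _ act_congruence_sym[OF conjunct1[OF \<sigma>] step[OF uv(2)]]]
        by blast
    qed
  qed (use hY gen in auto)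
  ultimately show ?thesis by blast
qed

section \<open>Quotient acts and finite presentability\<close>

lemma quotient_act_class:
  assumes "act_congruence S A \<rho>" "p \<in> carrier A" "s \<in> carrier S"
  shows "(\<rho> `` {p}) \<cdot>\<^bsub>quotient_act A \<rho>\<^esub> s = \<rho> `` {p \<cdot>\<^bsub>A\<^esub> s}"
proof -
  have eq: "equiv (carrier A) \<rho>" using assms(1) by (simp add: act_congruence_def)
  have "\<rho> `` {q \<cdot>\<^bsub>A\<^esub> s} = \<rho> `` {p \<cdot>\<^bsub>A\<^esub> s}" if "q \<in> \<rho> `` {p}" for q
  proof -
    have "(p \<cdot>\<^bsub>A\<^esub> s, q \<cdot>\<^bsub>A\<^esub> s) \<in> \<rho>"
      by (rule act_congruence_act[OF assms(1) _ assms(3)]) (use that in simp)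
    from equiv_class_eq[OF eq this] show ?thesis by simp
  qed
  moreover have "p \<in> \<rho> `` {p}" using act_congruence_refl[OF assms(1,2)] by simp
  ultimately have "(\<Union>q\<in>\<rho> `` {p}. \<rho> `` {q \<cdot>\<^bsub>A\<^esub> s}) = \<rho> `` {p \<cdot>\<^bsub>A\<^esub> s}" by blast
  thus ?thesis by (simp add: quotient_act_def)
qed

lemma carrier_quotient_act: "carrier (quotient_act A \<rho>) = (\<lambda>p. \<rho> `` {p}) ` carrier A"
  by (auto simp: quotient_act_def quotient_def)

lemma right_act_quotient:
  assumes A: "right_act S A" and "act_congruence S A \<rho>"
  shows "right_act S (quotient_act A \<rho>)"
proof -
  interpret right_act S A by (rule A)
  show ?thesis
    by unfold_locales
      (auto simp: carrier_quotient_act quotient_act_class[OF assms(2)] act_closed act_one act_assoc)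
qed

lemma class_eq_iff:
  assumes "act_congruence S A \<rho>" "p \<in> carrier A" "q \<in> carrier A"
  shows "\<rho> `` {p} = \<rho> `` {q} \<longleftrightarrow> (p, q) \<in> \<rho>"
proof -
  have "equiv (carrier A) \<rho>" using assms(1) by (simp add: act_congruence_def)
  thus ?thesis using assms(2,3) by (rule eq_equiv_class_iff)
qed

text \<open>With the preimages of the classes of \<open>(x, \<one>)\<close> as generators, the
  isomorphism carries \<open>ev A g p\<close> to the class of \<open>p\<close>. The kernel of
  evaluation is therefore \<open>\<rho>\<close> itself, and a finite generating set of
  \<open>\<rho>\<close> serves as \<open>H\<close>.\<close>

lemma fin_pres_imp_presents:
  fixes S (structure)
  assumes A: "right_act S A" and "fin_pres S A"
  obtains X :: "nat set" and g H where "finite X" "finite H" "presents S A X g H"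
proof -
  interpret right_act S A by (rule A)
  obtain X \<rho> f where X: "finite (X :: nat set)" "fg_congruence S (free_act S X) \<rho>"
    "f \<in> act_iso S A (quotient_act (free_act S X) \<rho>)"
    using assms(2) by (auto simp: fin_pres_def)
  define Q where "Q = quotient_act (free_act S X) \<rho>"
  have \<rho>: "act_congruence S (free_act S X) \<rho>" using X(2) by (simp add: fg_congruence_def)
  obtain H where H: "finite H" "H \<subseteq> \<rho>"
      "\<forall>\<sigma>. act_congruence S (free_act S X) \<sigma> \<and> H \<subseteq> \<sigma> \<longrightarrow> \<rho> \<subseteq> \<sigma>"
    using X(2) unfolding fg_congruence_def by (elim conjE exE)
  have bij: "bij_betw f (carrier A) (carrier Q)"
    and hom: "\<And>a s. a \<in> carrier A \<Longrightarrow> s \<in> carrier S \<Longrightarrow> f (a \<cdot>\<^bsub>A\<^esub> s) = f a \<cdot>\<^bsub>Q\<^esub> s"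
    using X(3) by (auto simp: act_iso_def Q_def)
  define g where "g x = inv_into (carrier A) f (\<rho> `` {(x, \<one>)})" for x
  have inQ: "\<rho> `` {p} \<in> carrier Q" if "p \<in> X \<times> carrier S" for p
    using that by (simp add: Q_def carrier_quotient_act)
  have g_in: "g x \<in> carrier A" and fg: "f (g x) = \<rho> `` {(x, \<one>)}" if "x \<in> X" for x
  proof -
    have "\<rho> `` {(x, \<one>)} \<in> f ` carrier A"
      using inQ[of "(x, \<one>)"] that bij by (simp add: bij_betw_def)
    thus "g x \<in> carrier A" "f (g x) = \<rho> `` {(x, \<one>)}"
      unfolding g_def by (rule inv_into_into, rule f_inv_into_f)
  qed
  have gX: "g ` X \<subseteq> carrier A" using g_in by auto
  have f_ev: "f (ev A g p) = \<rho> `` {p}" if pX: "p \<in> X \<times> carrier S" for p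
  proof -
    obtain x s where p: "p = (x, s)" "x \<in> X" "s \<in> carrier S" using pX by (rule SigmaE)
    have "f (g x \<cdot>\<^bsub>A\<^esub> s) = \<rho> `` {(x, \<one>)} \<cdot>\<^bsub>Q\<^esub> s" using p hom g_in fg by simp
    also have "\<dots> = \<rho> `` {(x, s)}"
      unfolding Q_def using quotient_act_class[OF \<rho>, of "(x, \<one>)" s] p by simp
    finally show ?thesis by (simp add: p)
  qed
  have ker: "ev_ker S A X g = \<rho>"
  proof -
    have "ev A g p = ev A g q \<longleftrightarrow> (p, q) \<in> \<rho>" if "p \<in> X \<times> carrier S" "q \<in> X \<times> carrier S" for p q
    proof -
      have "ev A g p = ev A g q \<longleftrightarrow> f (ev A g p) = f (ev A g q)"
        using inj_on_eq_iff[of f "carrier A"] bij ev_closed[OF gX that(1)] ev_closed[OF gX that(2)]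
        by (simp add: bij_betw_def)
      thus ?thesis using that f_ev class_eq_iff[OF \<rho>, of p q] by simp
    qed
    moreover have "\<rho> \<subseteq> (X \<times> carrier S) \<times> (X \<times> carrier S)"
      using act_congruence_subset[OF \<rho>] by simp
    ultimately show ?thesis unfolding ev_ker_def by blast
  qed
  have "carrier A \<subseteq> ev A g ` (X \<times> carrier S)"
  proof
    fix a assume a: "a \<in> carrier A"
    hence "f a \<in> carrier Q" using bij by (auto simp: bij_betw_def)
    then obtain p where p: "p \<in> X \<times> carrier S" "f a = \<rho> `` {p}"
      by (auto simp: Q_def carrier_quotient_act)
    hence "f a = f (ev A g p)" using f_ev by simp
    hence "a = ev A g p"
      using inj_onD[of f "carrier A"] ev_closed[OF gX p(1)] a bij by (simp add: bij_betw_def)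
    thus "a \<in> ev A g ` (X \<times> carrier S)" using p by blast
  qed
  hence gen: "carrier A = ev A g ` (X \<times> carrier S)"
    using ev_closed[OF gX] by (intro equalityI image_subsetI)
  have "presents S A X g H"
    unfolding presents_def ker using gX H(2,3) gen by (intro conjI allI impI) simp_all
  thus thesis using that X(1) H(1) by blast
qed

text \<open>\<open>fin_pres\<close> asks for generators in the naturals, so the finite index set is
  first renumbered and the relations are adapted by a change of generators. The isomorphism then
  sends an element to its fibre under evaluation, which is a class of the kernel.\<close>

lemma presents_imp_fin_pres:
  assumes A: "right_act S A" and pres0: "presents S A X0 g0 H0" and fin0: "finite X0" "finite H0"
  shows "fin_pres S A"
proof -
  interpret right_act S A by (rule A)
  define X where "X = {..<card X0}"
  obtain h where h: "bij_betw h X X0"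
    using ex_bij_betw_nat_finite[OF fin0(1)] by (auto simp: X_def atLeast0LessThan)
  define g where "g = g0 \<circ> h"
  have gX: "g ` X \<subseteq> carrier A"
    using h presentsD(1)[OF pres0] by (auto simp: g_def bij_betw_def image_comp[symmetric])
  have "ev A g ` (X \<times> carrier S) = ev A g0 ` (h ` X \<times> carrier S)"
    by (force simp: g_def image_iff)
  hence gen: "carrier A = ev A g ` (X \<times> carrier S)"
    using presentsD(2)[OF pres0] h by (simp add: bij_betw_def)
  obtain H where H: "finite H" "presents S A X g H"
    using presents_change_generators[OF A pres0 fin0(2) _ gX gen] by (auto simp: X_def)
  define \<rho> where "\<rho> = ev_ker S A X g"
  have \<rho>: "act_congruence S (free_act S X) \<rho>"
    unfolding \<rho>_def by (rule act_congruence_ev_ker[OF gX])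
  have "H \<subseteq> \<rho> \<and> (\<forall>\<sigma>. act_congruence S (free_act S X) \<sigma> \<and> H \<subseteq> \<sigma> \<longrightarrow> \<rho> \<subseteq> \<sigma>)"
    using H(2) unfolding presents_def \<rho>_def by (elim conjE) (rule conjI)
  hence fg: "fg_congruence S (free_act S X) \<rho>"
    unfolding fg_congruence_def using \<rho> H(1) by (intro conjI exI[of _ H]; elim conjE)
  define f where "f a = {p \<in> X \<times> carrier S. ev A g p = a}" for a
  have f_ev: "f (ev A g p) = \<rho> `` {p}" if "p \<in> X \<times> carrier S" for p
    using that by (auto simp: f_def \<rho>_def ev_ker_def)
  have inj: "inj_on f (carrier A)"
  proof (rule inj_onI)
    fix a b assume ab: "a \<in> carrier A" "b \<in> carrier A" "f a = f b"
    then obtain p where p: "p \<in> X \<times> carrier S" "a = ev A g p" using gen by auto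
    hence "p \<in> f b" unfolding ab(3)[symmetric] by (simp add: f_def)
    thus "a = b" using p by (simp add: f_def)
  qed
  have im: "f ` carrier A = carrier (quotient_act (free_act S X) \<rho>)"
    unfolding carrier_quotient_act gen image_image
    by (rule image_cong) (auto simp only: f_ev carrier_free_act)
  have "f (a \<cdot>\<^bsub>A\<^esub> s) = f a \<cdot>\<^bsub>quotient_act (free_act S X) \<rho>\<^esub> s"
    if a: "a \<in> carrier A" and s: "s \<in> carrier S" for a s
  proof -
    obtain p where p: "p \<in> X \<times> carrier S" "a = ev A g p" using gen a by auto
    have ps: "p \<cdot>\<^bsub>free_act S X\<^esub> s \<in> X \<times> carrier S" using p s by auto
    show ?thesis
      using ev_act[OF gX p(1) s] f_ev[OF p(1)] f_ev[OF ps] p s quotient_act_class[OF \<rho>, of p s]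
      by simp
  qed
  hence "f \<in> act_iso S A (quotient_act (free_act S X) \<rho>)"
    using inj im by (simp add: act_iso_def bij_betw_def)
  moreover have "finite X" by (simp add: X_def)
  ultimately show ?thesis using fg unfolding fin_pres_def
    by (intro exI[of _ X] exI[of _ \<rho>] exI[of _ f] conjI)
qed

text \<open>\<open>P\<close> is the free act on \<open>V\<close> modulo the intersection of all
  congruences containing \<open>H\<close>.\<close>

lemma exists_presented_act:
  fixes S :: "('s, 'k) monoid_scheme" (structure)
  assumes S: "monoid S" and H: "H \<subseteq> (V \<times> carrier S) \<times> (V \<times> carrier S)"
  obtains P :: "('s, ('v \<times> 's) set) act" and g
  where "right_act S P" "presents S P V g (H :: ('v \<times> 's) rel)"
proof -
  interpret monoid S by fact
  interpret F: right_act S "free_act S V" by (rule right_act_free[OF S])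
  define \<rho> where "\<rho> = \<Inter>{\<sigma>. act_congruence S (free_act S V) \<sigma> \<and> H \<subseteq> \<sigma>}"
  \<comment> \<open>The intersection is over a non-empty family, so it stays within the free
    act.\<close>
  have full: "act_congruence S (free_act S V) ((V \<times> carrier S) \<times> (V \<times> carrier S))"
    by (rule act_congruenceI) (auto intro: F.act_closed)
  have \<rho>: "act_congruence S (free_act S V) \<rho>"
  proof (rule act_congruenceI)
    fix p q r s
    show "\<rho> \<subseteq> carrier (free_act S V) \<times> carrier (free_act S V)"
      unfolding \<rho>_def by (rule Inter_lower) (use full H in simp)
    show "(p, p) \<in> \<rho>" if "p \<in> carrier (free_act S V)"
      unfolding \<rho>_def using act_congruence_refl[OF _ that] by blast
    show "(q, p) \<in> \<rho>" if "(p, q) \<in> \<rho>"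
      using that act_congruence_sym unfolding \<rho>_def by fast
    show "(p, r) \<in> \<rho>" if "(p, q) \<in> \<rho>" "(q, r) \<in> \<rho>"
      unfolding \<rho>_def
    proof (rule InterI)
      fix \<sigma> assume "\<sigma> \<in> {\<sigma>. act_congruence S (free_act S V) \<sigma> \<and> H \<subseteq> \<sigma>}"
      thus "(p, r) \<in> \<sigma>"
        using that act_congruence_trans[of S "free_act S V" \<sigma> p q r] unfolding \<rho>_def by simp
    qed
    show "(p \<cdot>\<^bsub>free_act S V\<^esub> s, q \<cdot>\<^bsub>free_act S V\<^esub> s) \<in> \<rho>" if "(p, q) \<in> \<rho>" "s \<in> carrier S"
      unfolding \<rho>_def
    proof (rule InterI)
      fix \<sigma> assume "\<sigma> \<in> {\<sigma>. act_congruence S (free_act S V) \<sigma> \<and> H \<subseteq> \<sigma>}"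
      thus "(p \<cdot>\<^bsub>free_act S V\<^esub> s, q \<cdot>\<^bsub>free_act S V\<^esub> s) \<in> \<sigma>"
        using that act_congruence_act[of S "free_act S V" \<sigma> p q s] unfolding \<rho>_def by simp
    qed
  qed
  define P where "P = quotient_act (free_act S V) \<rho>"
  define g where "g v = \<rho> `` {(v, \<one>)}" for v
  have ev: "ev P g p = \<rho> `` {p}" if pV: "p \<in> V \<times> carrier S" for p
  proof -
    obtain v s where p: "p = (v, s)" "v \<in> V" "s \<in> carrier S" using pV by (rule SigmaE)
    thus ?thesis using quotient_act_class[OF \<rho>, of "(v, \<one>)" s] by (simp add: P_def g_def)
  qed
  have ker: "ev_ker S P V g = \<rho>"
  proof -
    have "\<rho> \<subseteq> (V \<times> carrier S) \<times> (V \<times> carrier S)"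
      using act_congruence_subset[OF \<rho>] by simp
    moreover have "ev P g p = ev P g q \<longleftrightarrow> (p, q) \<in> \<rho>"
      if "p \<in> V \<times> carrier S" "q \<in> V \<times> carrier S" for p q
      using that ev class_eq_iff[OF \<rho>, of p q] by simp
    ultimately show ?thesis unfolding ev_ker_def by blast
  qed
  have "carrier P = ev P g ` (V \<times> carrier S)"
    unfolding P_def carrier_quotient_act
    by (rule image_cong) (auto simp only: ev P_def[symmetric] carrier_free_act)
  moreover have "g ` V \<subseteq> carrier P"
    by (auto simp: g_def P_def carrier_quotient_act)
  moreover have "H \<subseteq> \<rho>" unfolding \<rho>_def by blast
  moreover have "\<rho> \<subseteq> \<sigma>" if "act_congruence S (free_act S V) \<sigma> \<and> H \<subseteq> \<sigma>" for \<sigma>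
    unfolding \<rho>_def by (rule Inter_lower) (use that in simp)
  ultimately have "presents S P V g H"
    unfolding presents_def ker by (intro conjI allI impI)
  moreover have "right_act S P"
    unfolding P_def using \<rho> F.right_act_axioms by (intro right_act_quotient)
  ultimately show thesis using that by blast
qed

section \<open>Coherence in terms of presentations\<close>

lemma (in right_act) right_act_generated:
  assumes "c ` W \<subseteq> carrier A"
  shows "subact S (ev A c ` (W \<times> carrier S)) A"
    and "right_act S (A\<lparr>carrier := ev A c ` (W \<times> carrier S)\<rparr>)"
    and "c ` W \<subseteq> ev A c ` (W \<times> carrier S)"
proof -
  interpret F: right_act S "free_act S W" by (rule right_act_free) (rule monoid_axioms)
  let ?B = "ev A c ` (W \<times> carrier S)"
  have cl: "b \<cdot>\<^bsub>A\<^esub> s \<in> ?B" if b: "b \<in> ?B" and s: "s \<in> carrier S" for b s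
  proof -
    obtain p where p: "p \<in> W \<times> carrier S" "b = ev A c p" using b by (rule imageE)
    have "p \<cdot>\<^bsub>free_act S W\<^esub> s \<in> W \<times> carrier S" using F.act_closed[of p s] p(1) s by simp
    thus ?thesis using ev_act[OF assms p(1) s] p(2) by (metis imageI)
  qed
  have sub: "?B \<subseteq> carrier A" using ev_closed[OF assms] by blast
  show "subact S ?B A" using cl sub by (simp add: subact_def)
  show "right_act S (A\<lparr>carrier := ?B\<rparr>)"
    by unfold_locales (use cl sub in \<open>simp_all add: subset_iff act_one act_assoc\<close>)
  have "c w = ev A c (w, \<one>)" if "w \<in> W" for w
    using that assms by (simp add: act_one image_subset_iff)
  thus "c ` W \<subseteq> ?B" by blast
qed

text \<open>Coherence gives relations on some generators of the subact; a change of generators moves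
  them to the prescribed family \<open>c\<close>.\<close>

lemma right_coherent_presents:
  assumes coh: "right_coherent S" and A: "right_act S A" and fp: "fin_pres S A"
    and W: "finite W" "c ` W \<subseteq> carrier A"
  obtains G where "finite G" "presents S (A\<lparr>carrier := ev A c ` (W \<times> carrier S)\<rparr>) W c G"
proof -
  interpret right_act S A by (rule A)
  let ?B = "A\<lparr>carrier := ev A c ` (W \<times> carrier S)\<rparr>"
  note gen = right_act_generated[OF W(2)]
  have "fin_gen S ?B"
    unfolding fin_gen_def
  proof (intro exI[of _ "c ` W"] conjI)
    show "carrier ?B = (\<Union>a\<in>c ` W. (\<lambda>s. a \<cdot>\<^bsub>?B\<^esub> s) ` carrier S)" by (simp add: ev_image)
  qed (use W(1) gen(3) in simp_all)
  hence "fin_pres S ?B" by (rule right_coherentD[OF coh A fp gen(1)])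
  then obtain X :: "nat set" and g H where "finite X" "finite H" "presents S ?B X g H"
    by (rule fin_pres_imp_presents[OF gen(2)])
  hence "\<exists>G. finite G \<and> presents S ?B W c G"
    using gen(3) by (intro presents_change_generators[OF gen(2) _ _ W(1)]) simp_all
  thus thesis using that by blast
qed

text \<open>A finitely generated subact has a finite subset \<open>F\<close> as generators, indexed
  by itself through \<open>id\<close>, and the kernel is the same whether computed in
  \<open>A\<close> or in the subact.\<close>

lemma right_coherentI:
  assumes "\<And>(A :: ('s, (nat \<times> 's) set) act) (X :: nat set) g H F.
      right_act S A \<Longrightarrow> finite X \<Longrightarrow> finite H \<Longrightarrow> presents S A X g H \<Longrightarrow> finite F \<Longrightarrow> F \<subseteq> carrier A \<Longrightarrow>
      \<exists>G. finite G \<and> G \<subseteq> ev_ker S A F id \<and>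
        (\<forall>\<sigma>. act_congruence S (free_act S F) \<sigma> \<and> G \<subseteq> \<sigma> \<longrightarrow> ev_ker S A F id \<subseteq> \<sigma>)"
  shows "right_coherent S"
  unfolding right_coherent_def
proof (intro allI impI, elim conjE)
  fix A :: "('s, (nat \<times> 's) set) act" and B
  assume A: "right_act S A" and fp: "fin_pres S A" and "subact S B A"
    and fg: "fin_gen S (A\<lparr>carrier := B\<rparr>)"
  interpret right_act S A by (rule A)
  obtain X :: "nat set" and g H where X: "finite X" "finite H" "presents S A X g H"
    by (rule fin_pres_imp_presents[OF A fp])
  obtain F where F: "finite F" "F \<subseteq> B" and B: "B = (\<Union>a\<in>F. (\<lambda>s. a \<cdot>\<^bsub>A\<^esub> s) ` carrier S)"
    using fg by (auto simp: fin_gen_def)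
  have FA: "F \<subseteq> carrier A" using F \<open>subact S B A\<close> by (auto simp: subact_def)
  have B': "B = ev A id ` (F \<times> carrier S)" unfolding B by (simp add: ev_image)
  have ker: "ev_ker S (A\<lparr>carrier := B\<rparr>) F id = ev_ker S A F id" by (simp add: ev_ker_def)
  obtain G where G: "finite G" "G \<subseteq> ev_ker S A F id"
     "\<forall>\<sigma>. act_congruence S (free_act S F) \<sigma> \<and> G \<subseteq> \<sigma> \<longrightarrow> ev_ker S A F id \<subseteq> \<sigma>"
    using assms[OF A X F(1) FA] by (elim exE conjE)
  have "presents S (A\<lparr>carrier := B\<rparr>) F id G"
    unfolding presents_def ker using G F(2) B' by simp
  moreover have "right_act S (A\<lparr>carrier := B\<rparr>)"
    unfolding B' by (rule right_act_generated) (use FA in simp)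
  ultimately show "fin_pres S (A\<lparr>carrier := B\<rparr>)"
    using presents_imp_fin_pres[OF _ _ F(1) G(1)] by blast
qed

section \<open>Acts over Brandt monoids\<close>

text \<open>\<open>T\<close> is a left ideal, so testing the image of \<open>p\<close> under
  \<open>s\<close> with \<open>t\<close> amounts to testing \<open>p\<close> with
  \<open>s \<otimes> t\<close>, again in \<open>T\<close>. A function \<open>f\<close> on an act
  thus yields a congruence, and its invariance need be checked on generating relations only.\<close>

lemma (in right_act) act_congruence_syntactic:
  assumes "T \<subseteq> carrier S" "\<And>s t. s \<in> carrier S \<Longrightarrow> t \<in> T \<Longrightarrow> s \<otimes> t \<in> T"
  shows "act_congruence S A {(p, q). p \<in> carrier A \<and> q \<in> carrier A \<and>
    (\<forall>t\<in>T. f (p \<cdot>\<^bsub>A\<^esub> t) = f (q \<cdot>\<^bsub>A\<^esub> t))}"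
proof (rule act_congruenceI)
  fix p q s
  let ?R = "{(p, q). p \<in> carrier A \<and> q \<in> carrier A \<and> (\<forall>t\<in>T. f (p \<cdot>\<^bsub>A\<^esub> t) = f (q \<cdot>\<^bsub>A\<^esub> t))}"
  show "(p \<cdot>\<^bsub>A\<^esub> s, q \<cdot>\<^bsub>A\<^esub> s) \<in> ?R" if pq: "(p, q) \<in> ?R" and s: "s \<in> carrier S"
  proof -
    have "f (p \<cdot>\<^bsub>A\<^esub> s \<cdot>\<^bsub>A\<^esub> t) = f (q \<cdot>\<^bsub>A\<^esub> s \<cdot>\<^bsub>A\<^esub> t)" if t: "t \<in> T" for t
    proof -
      have "t \<in> carrier S" using t assms(1) by blast
      moreover have "f (p \<cdot>\<^bsub>A\<^esub> (s \<otimes> t)) = f (q \<cdot>\<^bsub>A\<^esub> (s \<otimes> t))"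
        using pq assms(2)[OF s t] by simp
      ultimately show ?thesis using pq s by (simp add: act_assoc)
    qed
    thus ?thesis using pq s by (simp add: act_closed)
  qed
qed auto

section \<open>Arithmetic of the Brandt monoid\<close>

lemma carrier_brandt_monoid:
  "s \<in> carrier (brandt_monoid M I) \<longleftrightarrow> s = None \<or> s = Some Zero \<or>
    (\<exists>i m k. s = Some (Elt i m k) \<and> i \<in> I \<and> m \<in> carrier M \<and> k \<in> I)"
  by (auto simp: brandt_monoid_def adjoin_one_def brandt_carrier_def)

lemma one_brandt_monoid [simp]: "\<one>\<^bsub>brandt_monoid M I\<^esub> = None"
  by (simp add: brandt_monoid_def adjoin_one_def)

lemma adjoin_mult_None_right [simp]: "adjoin_mult f x None = x"
  by (cases x) auto

lemma mult_brandt_monoid [simp]: "s \<otimes>\<^bsub>brandt_monoid M I\<^esub> t = adjoin_mult (brandt_mult M) s t"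
  by (simp add: brandt_monoid_def adjoin_one_def)

lemma adjoin_mult_Zero_right [simp]: "adjoin_mult (brandt_mult M) s (Some Zero) = Some Zero"
  by (cases s) auto

lemma mult_brandt_eq_None: "adjoin_mult f s t = None \<longleftrightarrow> s = None \<and> t = None"
  by (cases s; cases t) auto

section \<open>Translation of words to the monoid M\<close>

fun idx :: "('i, 'm) brandt option \<Rightarrow> 'i set" where
  "idx (Some (Elt i m k)) = {i, k}"
| "idx (Some Zero) = {}"
| "idx None = {}"

fun strip :: "'x \<times> ('i, 'm) brandt option \<Rightarrow> (('x \<times> 'i) \<times> 'm) option" where
  "strip (x, Some (Elt i m k)) = Some ((x, i), m)"
| "strip (x, Some Zero) = None"
| "strip (x, None) = None"

text \<open>For a fixed index \<open>o\<close>, a generator \<open>x\<close> of \<open>A\<close> contributes the generators \<open>x (i, 1, o)\<close> to the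
  \<open>M\<close>-act \<open>A (o, 1, o)\<close>. The function \<open>row\<close> expresses \<open>p (j, 1, o)\<close> in them, with value
  \<^term>\<open>None\<close> if it is literally a zero; the target index \<open>o\<close> is immaterial.\<close>

definition row ::
  "('m, 'k) monoid_scheme \<Rightarrow> 'i \<Rightarrow> 'x \<times> ('i, 'm) brandt option \<Rightarrow> (('x \<times> 'i) \<times> 'm) option" where
  "row M j p = strip (fst p, adjoin_mult (brandt_mult M) (snd p) (Some (Elt j \<one>\<^bsub>M\<^esub> j)))"

lemma row_in:
  assumes "monoid M" "p \<in> X \<times> carrier (brandt_monoid M I)" "idx (snd p) \<subseteq> J" "j \<in> J" "row M j p = Some a"
  shows "a \<in> (X \<times> J) \<times> carrier M"
proof -
  obtain x s where p: "p = (x, s)" "x \<in> X" "s \<in> carrier (brandt_monoid M I)" using assms(2) by (rule SigmaE)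
  show ?thesis
    using p assms monoid.one_closed[OF assms(1)] monoid.m_closed[OF assms(1)]
    by (auto simp: carrier_brandt_monoid row_def split: if_splits)
qed

text \<open>A section of \<open>strip\<close>, with \<open>k\<close> restored as the right
  index.\<close>

fun unrow :: "'i \<Rightarrow> ('x \<times> 'i) \<times> 'm \<Rightarrow> 'x \<times> ('i, 'm) brandt option" where
  "unrow k ((x, i), m) = (x, Some (Elt i m k))"

text \<open>Both sides of a relation are multiplied by \<open>(j, 1, j)\<close>. Two nonzero results
  give a relation between words over \<open>M\<close>; a single nonzero result is recorded in
  \<open>zero_rows\<close>, since an \<open>M\<close>-act need not have a zero to equate it
  with.\<close>

definition row_rels ::
  "('m, 'k) monoid_scheme \<Rightarrow> 'i set \<Rightarrow> ('x \<times> ('i, 'm) brandt option) rel \<Rightarrow> (('x \<times> 'i) \<times> 'm) rel" where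
  "row_rels M J H = {(a, b). \<exists>(p, q)\<in>H. \<exists>j\<in>J. row M j p = Some a \<and> row M j q = Some b}"

definition zero_rows ::
  "('m, 'k) monoid_scheme \<Rightarrow> 'i set \<Rightarrow> ('x \<times> ('i, 'm) brandt option) rel \<Rightarrow> (('x \<times> 'i) \<times> 'm) set" where
  "zero_rows M J H = {a. \<exists>(p, q)\<in>H. \<exists>j\<in>J.
     row M j p = Some a \<and> row M j q = None \<or> row M j p = None \<and> row M j q = Some a}"

lemma finite_row_rels:
  assumes "finite H" "finite J"
  shows "finite (row_rels M J H)"
proof (rule finite_subset)
  show "row_rels M J H \<subseteq> (\<lambda>((p, q), j). (the (row M j p), the (row M j q))) ` (H \<times> J)"
    unfolding row_rels_def by force
qed (use assms in simp)

lemma finite_zero_rows: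
  assumes "finite H" "finite J"
  shows "finite (zero_rows M J H)"
proof (rule finite_subset)
  show "zero_rows M J H \<subseteq> (\<lambda>((p, q), j). the (row M j p)) ` (H \<times> J) \<union>
      (\<lambda>((p, q), j). the (row M j q)) ` (H \<times> J)"
    unfolding zero_rows_def by force
qed (use assms in simp)

text \<open>Relations on the subact of \<open>P\<close>, carried back to \<open>A\<close>.
  \<open>Inl (y, i)\<close> stands for \<open>y (i, 1, o)\<close> and \<open>Inr d\<close> for a
  generator of the collapsed part, so equality with an \<open>Inr\<close> word means vanishing in
  \<open>A\<close>; two \<open>Inr\<close> words impose nothing on the generators
  \<open>y\<close>.\<close>

fun lift_pair :: "'i \<Rightarrow> (('a \<times> 'i + 'd) \<times> 'm) \<times> (('a \<times> 'i + 'd) \<times> 'm) \<Rightarrow>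
    ('a \<times> ('i, 'm) brandt option) rel" where
  "lift_pair k ((Inl (y, i), m), (Inl (z, j), n)) = {((y, Some (Elt i m k)), (z, Some (Elt j n k)))}"
| "lift_pair k ((Inl (y, i), m), (Inr d, n)) = {((y, Some (Elt i m k)), (y, Some Zero))}"
| "lift_pair k ((Inr d, n), (Inl (y, i), m)) = {((y, Some (Elt i m k)), (y, Some Zero))}"
| "lift_pair k ((Inr d, n), (Inr d', n')) = {}"

lemma finite_lift_pair [simp]: "finite (lift_pair k pq)"
  by (cases "(k, pq)" rule: lift_pair.cases) auto

text \<open>\<open>w\<close> writes the elements of \<open>F\<close> as words over \<open>X\<close>,
  and \<open>e\<close> selects for each \<open>y\<close> that admits one an element fixing it. The
  indices of \<open>H\<close>, of \<open>w\<close> and of these values of \<open>e\<close> all lie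
  in \<open>J\<close>. \<open>P\<close> is any \<open>M\<close>-act presented by the rows of
  \<open>H\<close>, and \<open>i0\<close> is the fixed index \<open>o\<close>.\<close>

locale brandt_presentation = M: monoid M + A: right_act "brandt_monoid M I" A + P: right_act M P
  for M :: "('m, 'k) monoid_scheme" and I :: "'i set"
    and A :: "(('i, 'm) brandt option, 'a) act" and P :: "('m, 'p) act" +
  fixes i0 :: 'i and X :: "'x set" and g H F w e J gP
  assumes i0: "i0 \<in> I" and J: "finite J" "J \<subseteq> I"
    and presA: "presents (brandt_monoid M I) A X g H"
    and idxH: "\<And>p q. (p, q) \<in> H \<Longrightarrow> idx (snd p) \<subseteq> J \<and> idx (snd q) \<subseteq> J"
    and F: "finite F" "F \<subseteq> carrier A"
    and w: "\<And>y. y \<in> F \<Longrightarrow> w y \<in> X \<times> carrier (brandt_monoid M I) \<and> ev A g (w y) = y \<and> idx (snd (w y)) \<subseteq> J"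
    and e: "\<And>y s. y \<in> F \<Longrightarrow> s \<in> insert (Some Zero) ((\<lambda>r. Some (Elt r \<one>\<^bsub>M\<^esub> r)) ` I) \<Longrightarrow> y \<cdot>\<^bsub>A\<^esub> s = y \<Longrightarrow>
      e y \<in> insert (Some Zero) ((\<lambda>r. Some (Elt r \<one>\<^bsub>M\<^esub> r)) ` J) \<and> y \<cdot>\<^bsub>A\<^esub> e y = y"
    and presP: "presents M P (X \<times> J) gP (row_rels M J H)"
begin

section \<open>Elements of A and their rows\<close>

abbreviation "S \<equiv> brandt_monoid M I"

abbreviation E where "E i m k \<equiv> Some (Elt i m k)"

abbreviation Z where "Z \<equiv> Some Zero"

abbreviation act_A (infixl \<open>\<star>\<close> 70) where "a \<star> s \<equiv> a \<cdot>\<^bsub>A\<^esub> s"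

abbreviation evA where "evA \<equiv> ev A g"

abbreviation evP where "evP \<equiv> ev P gP"

abbreviation D where "D \<equiv> zero_rows M J H"

lemma E_in [simp]: "E i m k \<in> carrier S \<longleftrightarrow> i \<in> I \<and> m \<in> carrier M \<and> k \<in> I"
  and Z_in [simp]: "Z \<in> carrier S"
  and None_in [simp]: "None \<in> carrier S"
  by (simp_all add: carrier_brandt_monoid)

lemma S_cases:
  assumes "s \<in> carrier S"
  obtains "s = None" | "s = Z" | i m k where "s = E i m k" "i \<in> I" "m \<in> carrier M" "k \<in> I"
  using assms by (auto simp: carrier_brandt_monoid)

lemma act_act:
  assumes "a \<in> carrier A" "s \<in> carrier S" "t \<in> carrier S"
  shows "a \<star> s \<star> t = a \<star> adjoin_mult (brandt_mult M) s t"
  using A.act_assoc[OF assms] by simp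

lemma J_in_I: "j \<in> J \<Longrightarrow> j \<in> I"
  using J(2) by blast

lemma g_in: "x \<in> X \<Longrightarrow> g x \<in> carrier A"
  using presentsD(1)[OF presA] by blast

lemma act_None: "a \<in> carrier A \<Longrightarrow> a \<star> None = a"
  using A.act_one by simp

lemma evA_Z:
  assumes "p \<in> X \<times> carrier S"
  shows "evA p \<star> Z = g (fst p) \<star> Z"
  using assms by (cases p) (simp add: act_act g_in)

text \<open>Equivalent to being a product \<open>b \<star> s\<close> with
  \<open>s \<noteq> None\<close>. In this form the property is witnessed by a single equation
  \<open>a = a e\<close>, which can be listed among finitely many relations.\<close>

definition reducible where
  "reducible a \<longleftrightarrow> a \<star> Z = a \<or> (\<exists>r\<in>I. a \<star> E r \<one>\<^bsub>M\<^esub> r = a)"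

lemma reducible_act:
  assumes "a \<in> carrier A" "s \<in> carrier S" "s \<noteq> None"
  shows "reducible (a \<star> s)"
  using assms(2)
proof (cases rule: S_cases)
  case 2
  thus ?thesis using assms(1) by (simp add: reducible_def act_act)
next
  case (3 i m k)
  hence "a \<star> s \<star> E k \<one>\<^bsub>M\<^esub> k = a \<star> s"
    using assms(1) by (simp add: act_act)
  thus ?thesis unfolding reducible_def using 3(4) by blast
qed (use assms(3) in simp)

lemma row_Some:
  assumes "p \<in> X \<times> carrier S" "j \<in> J" "row M j p = Some a" "n \<in> carrier M"
  shows "evA p \<star> E j n i0 = evA (unrow i0 (fst a, snd a \<otimes>\<^bsub>M\<^esub> n))"
proof -
  obtain x s where p: "p = (x, s)" "x \<in> X" "s \<in> carrier S" using assms(1) by (rule SigmaE)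
  show ?thesis
    using p(3)
  proof (cases rule: S_cases)
    case 1
    thus ?thesis using p assms i0 J_in_I by (auto simp: row_def act_act g_in)
  next
    case 2
    thus ?thesis using p assms by (simp add: row_def)
  next
    case (3 i m k)
    thus ?thesis using p assms i0 J_in_I
      by (auto simp: row_def act_act g_in M.m_assoc split: if_splits)
  qed
qed

lemma row_None:
  assumes "p \<in> X \<times> carrier S" "j \<in> J" "row M j p = None" "n \<in> carrier M" "k \<in> I"
  shows "evA p \<star> E j n k = g (fst p) \<star> Z"
proof -
  obtain x s where p: "p = (x, s)" "x \<in> X" "s \<in> carrier S" using assms(1) by (rule SigmaE)
  show ?thesis
    using p(3)
  proof (cases rule: S_cases)
    case 1
    thus ?thesis using p assms by (simp add: row_def)
  next
    case 2
    thus ?thesis using p assms J_in_I by (simp add: act_act g_in)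
  next
    case (3 i m k)
    thus ?thesis using p assms J_in_I by (auto simp: row_def act_act g_in split: if_splits)
  qed
qed

section \<open>Comparison of P with A (o, 1, o)\<close>

lemma unrow_in: "a \<in> (X \<times> J) \<times> carrier M \<Longrightarrow> unrow i0 a \<in> X \<times> carrier S"
  using i0 J_in_I by (cases a) auto

lemma evA_unrow_act:
  assumes "a \<in> (X \<times> J) \<times> carrier M" "n \<in> carrier M"
  shows "evA (unrow i0 (fst a, snd a \<otimes>\<^bsub>M\<^esub> n)) = evA (unrow i0 a) \<star> E i0 n i0"
proof -
  obtain x i m where "a = ((x, i), m)" "x \<in> X" "i \<in> J" "m \<in> carrier M" using assms(1) by auto
  thus ?thesis using assms(2) i0 J_in_I by (simp add: act_act g_in)
qed

lemma evA_row:
  assumes "p \<in> X \<times> carrier S" "idx (snd p) \<subseteq> J" "j \<in> J" "row M j p = Some a"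
  shows "evA p \<star> E j \<one>\<^bsub>M\<^esub> i0 = evA (unrow i0 a)"
  using row_Some[OF assms(1,3,4) M.one_closed] row_in[OF M.monoid_axioms assms] by (cases a) auto

text \<open>The relations \<open>row_rels M J H\<close> hold in \<open>A\<close> for the elements
  \<open>x (i, 1, o)\<close>. Hence these elements define a map of \<open>M\<close>-acts from
  \<open>P\<close> to \<open>A (o, 1, o)\<close>, here stated on representatives.\<close>

lemma row_rels_unrow:
  assumes "a \<in> (X \<times> J) \<times> carrier M" "b \<in> (X \<times> J) \<times> carrier M" "evP a = evP b"
  shows "evA (unrow i0 a) = evA (unrow i0 b)"
proof -
  define \<sigma> where "\<sigma> = {(a, b). a \<in> (X \<times> J) \<times> carrier M \<and> b \<in> (X \<times> J) \<times> carrier M \<and>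
    evA (unrow i0 a) = evA (unrow i0 b)}"
  have "act_congruence M (free_act M (X \<times> J)) \<sigma>"
  proof (rule act_congruenceI)
    fix a b n assume ab: "(a, b) \<in> \<sigma>" and n: "n \<in> carrier M"
    have "evA (unrow i0 (fst a, snd a \<otimes>\<^bsub>M\<^esub> n)) = evA (unrow i0 (fst b, snd b \<otimes>\<^bsub>M\<^esub> n))"
      using ab evA_unrow_act n by (simp add: \<sigma>_def)
    thus "(a \<cdot>\<^bsub>free_act M (X \<times> J)\<^esub> n, b \<cdot>\<^bsub>free_act M (X \<times> J)\<^esub> n) \<in> \<sigma>"
      using ab n unfolding \<sigma>_def by auto
  qed (auto simp: \<sigma>_def)
  moreover have "row_rels M J H \<subseteq> \<sigma>"
  proof (rule subrelI)
    fix a b assume "(a, b) \<in> row_rels M J H"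
    then obtain p q j where pq: "(p, q) \<in> H" "j \<in> J" "row M j p = Some a" "row M j q = Some b"
      unfolding row_rels_def by blast
    note in_H = presentsD(3)[OF presA pq(1)] and idx = idxH[OF pq(1)]
    show "(a, b) \<in> \<sigma>"
      using in_H idx pq row_in[OF M.monoid_axioms, of p X I J j a] row_in[OF M.monoid_axioms, of q X I J j b]
        evA_row[of p j a] evA_row[of q j b]
      by (simp add: \<sigma>_def)
  qed
  ultimately have "(a, b) \<in> \<sigma>" using presentsD(4)[OF presP] assms by blast
  thus ?thesis by (simp add: \<sigma>_def)
qed

text \<open>Multiplying the two sides of the relation by \<open>(j, 1, o)\<close> gives the value of
  \<open>d\<close> on one side and an element of \<open>A 0\<close> on the other.\<close>

lemma D_in: "d \<in> D \<Longrightarrow> d \<in> (X \<times> J) \<times> carrier M"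
  and D_zero: "d \<in> D \<Longrightarrow> evA (unrow i0 d) \<star> Z = evA (unrow i0 d)"
proof -
  assume "d \<in> D"
  then obtain p q j where pq: "(p, q) \<in> H" "j \<in> J"
    "row M j p = Some d \<and> row M j q = None \<or> row M j p = None \<and> row M j q = Some d"
    unfolding zero_rows_def by blast
  have "\<exists>p q. p \<in> X \<times> carrier S \<and> q \<in> X \<times> carrier S \<and> evA p = evA q \<and> idx (snd p) \<subseteq> J \<and>
      row M j p = Some d \<and> row M j q = None"
    using pq(3) presentsD(3)[OF presA pq(1)] idxH[OF pq(1)] by metis
  then obtain p q where *: "p \<in> X \<times> carrier S" "q \<in> X \<times> carrier S" "evA p = evA q"
    "idx (snd p) \<subseteq> J" "row M j p = Some d" "row M j q = None" by blast
  show "d \<in> (X \<times> J) \<times> carrier M"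
    by (rule row_in[OF M.monoid_axioms *(1,4) pq(2) *(5)])
  have "evA (unrow i0 d) = g (fst q) \<star> Z"
    using evA_row[OF *(1,4) pq(2) *(5)] row_None[OF *(2) pq(2) *(6) M.one_closed i0] *(3) by simp
  moreover have "g (fst q) \<in> carrier A" using *(2) g_in by auto
  ultimately show "evA (unrow i0 d) \<star> Z = evA (unrow i0 d)" by (simp add: act_act)
qed

text \<open>The subact of \<open>P\<close> generated by \<open>D\<close>: the outer
  \<open>ev\<close> takes the elements of \<open>D\<close> as free generators, with values
  \<open>evP\<close>. It is the part of \<open>P\<close> mapped into the zeros of \<open>A\<close>,
  by \<open>D_generated_zero\<close> and \<open>unrow_zeroD\<close>.\<close>

definition DP where "DP = ev P evP ` (D \<times> carrier M)"

lemma D_generated_zero: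
  assumes a: "a \<in> (X \<times> J) \<times> carrier M" and "evP a \<in> DP"
  shows "evA (unrow i0 a) \<star> Z = evA (unrow i0 a)"
proof -
  obtain p where p: "evP a = ev P evP p" "p \<in> D \<times> carrier M"
    using assms(2) unfolding DP_def by (rule imageE)
  obtain d n where dn: "p = (d, n)" and d: "d \<in> D" "n \<in> carrier M" using p(2) by (rule SigmaE)
  have "evP (fst d, snd d \<otimes>\<^bsub>M\<^esub> n) = evP d \<cdot>\<^bsub>P\<^esub> n"
    using P.ev_act[OF presentsD(1)[OF presP] D_in[OF d(1)] d(2)]
    by (subst (asm) prod.collapse[of d, symmetric]) (simp only: act_free_act ev_def fst_conv snd_conv)
  moreover have "(fst d, snd d \<otimes>\<^bsub>M\<^esub> n) \<in> (X \<times> J) \<times> carrier M"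
    using D_in[OF d(1)] d(2) by (simp add: mem_Times_iff)
  ultimately have "evA (unrow i0 a) = evA (unrow i0 (fst d, snd d \<otimes>\<^bsub>M\<^esub> n))"
    by (intro row_rels_unrow[OF a]) (simp_all only: p(1) dn ev_simp)
  also have "\<dots> = evA (unrow i0 d) \<star> E i0 n i0" by (rule evA_unrow_act[OF D_in[OF d(1)] d(2)])
  also have "\<dots> = evA (unrow i0 d) \<star> Z \<star> E i0 n i0" by (simp only: D_zero[OF d(1)])
  finally have eq: "evA (unrow i0 a) = evA (unrow i0 d) \<star> Z \<star> E i0 n i0" .
  have "evA (unrow i0 d) \<in> carrier A"
    by (rule A.ev_closed[OF presentsD(1)[OF presA] unrow_in[OF D_in[OF d(1)]]])
  hence "evA (unrow i0 d) \<star> Z \<star> E i0 n i0 \<star> Z = evA (unrow i0 d) \<star> Z \<star> E i0 n i0"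
    using d(2) i0 by (simp add: act_act)
  thus ?thesis by (simp only: eq)
qed

text \<open>Being compatible with the relations of \<open>H\<close> up to multiplication by elements other than \<open>1\<close>,
  \<open>cls\<close> separates the elements of \<open>A (o, 1, o)\<close> that differ in \<open>P\<close> with \<open>DP\<close> collapsed.\<close>

definition cls where
  "cls p = (case strip p of None \<Rightarrow> None
    | Some a \<Rightarrow> if snd (fst a) \<in> J \<and> evP a \<notin> DP then Some (evP a) else None)"

lemma cls_row:
  assumes "p \<in> X \<times> carrier S" "idx (snd p) \<subseteq> J" "j \<in> J" "n \<in> carrier M"
  shows "cls (fst p, adjoin_mult (brandt_mult M) (snd p) (E j n k)) = (case row M j p of None \<Rightarrow> None
    | Some a \<Rightarrow> if evP a \<cdot>\<^bsub>P\<^esub> n \<notin> DP then Some (evP a \<cdot>\<^bsub>P\<^esub> n) else None)"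
proof -
  obtain x s where p: "p = (x, s)" "x \<in> X" "s \<in> carrier S" using assms(1) by (rule SigmaE)
  have gP: "gP (x, i) \<in> carrier P" if "i \<in> J" for i
    using presentsD(1)[OF presP] that p(2) by blast
  show ?thesis
    using p(3)
  proof (cases rule: S_cases)
    case 1
    thus ?thesis using p assms gP by (simp add: row_def cls_def P.act_assoc[symmetric])
  next
    case 2
    thus ?thesis using p by (simp add: row_def cls_def)
  next
    case (3 i m k)
    thus ?thesis using p assms gP by (simp add: row_def cls_def P.act_assoc[symmetric])
  qed
qed

text \<open>If the word is a free generator, the product has left index \<open>j\<close> outside
  \<open>J\<close>; otherwise the inner indices disagree or a zero is present. \<open>cls\<close>
  gives both the value \<open>None\<close>.\<close>

lemma cls_not_J:
  assumes "idx (snd p) \<subseteq> J" "j \<notin> J"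
  shows "cls (fst p, adjoin_mult (brandt_mult M) (snd p) (E j n k)) = None"
proof (cases "snd p")
  case None
  thus ?thesis using assms by (simp add: cls_def)
next
  case (Some b)
  thus ?thesis using assms by (cases b) (auto simp: cls_def)
qed

lemma DP_act: "b \<in> DP \<Longrightarrow> n \<in> carrier M \<Longrightarrow> b \<cdot>\<^bsub>P\<^esub> n \<in> DP"
proof -
  assume b: "b \<in> DP" and n: "n \<in> carrier M"
  have "evP ` D \<subseteq> carrier P"
    by (intro image_subsetI P.ev_closed[OF presentsD(1)[OF presP] D_in])
  from P.right_act_generated(1)[OF this] have "subact M DP P" unfolding DP_def .
  thus ?thesis using b n by (simp add: subact_def)
qed

lemma D_in_DP: "d \<in> D \<Longrightarrow> evP d \<in> DP"
proof -
  assume d: "d \<in> D"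
  have "evP ` D \<subseteq> carrier P"
    by (intro image_subsetI P.ev_closed[OF presentsD(1)[OF presP] D_in])
  from P.right_act_generated(3)[OF this] show ?thesis
    using d unfolding DP_def by blast
qed

text \<open>It is enough to treat pairs in \<open>H\<close>, by
  \<open>act_congruence_syntactic\<close>. For \<open>j\<close> in \<open>J\<close>, two nonzero
  rows agree in \<open>P\<close> by \<open>row_rels\<close>, while a nonzero row opposite a zero row
  lies in \<open>D\<close>, where \<open>cls\<close> also gives \<open>None\<close>. For other
  \<open>j\<close> both sides are \<open>None\<close>.\<close>

lemma cls_cong:
  assumes "p \<in> X \<times> carrier S" "q \<in> X \<times> carrier S" "evA p = evA q" "n \<in> carrier M" "j \<in> I" "k \<in> I"
  shows "cls (fst p, adjoin_mult (brandt_mult M) (snd p) (E j n k)) =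
    cls (fst q, adjoin_mult (brandt_mult M) (snd q) (E j n k))"
proof -
  interpret FX: right_act S "free_act S X" by (rule right_act_free) (rule A.monoid_axioms)
  \<comment> \<open>The identity is excluded as a test: a relation such as
    \<open>x = x' (i, m, k)\<close> in \<open>H\<close> need not itself preserve
    \<open>cls\<close>.\<close>
  define \<sigma> where "\<sigma> = {(p, q). p \<in> carrier (free_act S X) \<and> q \<in> carrier (free_act S X) \<and>
    (\<forall>t\<in>carrier S - {None}. cls (p \<cdot>\<^bsub>free_act S X\<^esub> t) = cls (q \<cdot>\<^bsub>free_act S X\<^esub> t))}"
  have cong: "act_congruence S (free_act S X) \<sigma>"
    unfolding \<sigma>_def
  proof (rule FX.act_congruence_syntactic)
    fix s t assume "s \<in> carrier S" "t \<in> carrier S - {None}"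
    thus "s \<otimes>\<^bsub>S\<^esub> t \<in> carrier S - {None}"
      using A.m_closed[of s t] by (simp add: mult_brandt_eq_None)
  qed blast
  have "H \<subseteq> \<sigma>"
  proof (rule subrelI)
    fix p q assume pq: "(p, q) \<in> H"
    obtain x s y u where xy: "p = (x, s)" "q = (y, u)" by (cases p; cases q) auto
    note in_H = presentsD(3)[OF presA pq] and idx = idxH[OF pq]
    have "cls (p \<cdot>\<^bsub>free_act S X\<^esub> t) = cls (q \<cdot>\<^bsub>free_act S X\<^esub> t)" if "t \<in> carrier S" "t \<noteq> None" for t
      using that(1)
    proof (cases rule: S_cases)
      case 2
      thus ?thesis using xy by (simp add: cls_def)
    next
      case (3 j n k)
      show ?thesis
      proof (cases "j \<in> J")
        case False
        thus ?thesis using cls_not_J[of p j n k] cls_not_J[of q j n k] idx 3 xy by simp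
      next
        case True
        have cr: "cls (p \<cdot>\<^bsub>free_act S X\<^esub> t) = (case row M j p of None \<Rightarrow> None
            | Some a \<Rightarrow> if evP a \<cdot>\<^bsub>P\<^esub> n \<notin> DP then Some (evP a \<cdot>\<^bsub>P\<^esub> n) else None)"
          "cls (q \<cdot>\<^bsub>free_act S X\<^esub> t) = (case row M j q of None \<Rightarrow> None
            | Some a \<Rightarrow> if evP a \<cdot>\<^bsub>P\<^esub> n \<notin> DP then Some (evP a \<cdot>\<^bsub>P\<^esub> n) else None)"
          using cls_row[of p j n k] cls_row[of q j n k] in_H idx True 3 xy by simp_all
        have zero: "evP a \<cdot>\<^bsub>P\<^esub> n \<in> DP" if "a \<in> D" for a
          using DP_act[OF D_in_DP[OF that] 3(3)] .
        show ?thesis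
        proof (cases "row M j p"; cases "row M j q")
          fix a assume *: "row M j p = None" "row M j q = Some a"
          hence "a \<in> D" using pq True unfolding zero_rows_def by blast
          thus ?thesis using cr * zero by simp
        next
          fix a assume *: "row M j p = Some a" "row M j q = None"
          hence "a \<in> D" using pq True unfolding zero_rows_def by blast
          thus ?thesis using cr * zero by simp
        next
          fix a b assume *: "row M j p = Some a" "row M j q = Some b"
          hence "(a, b) \<in> row_rels M J H" using pq True unfolding row_rels_def by blast
          hence "evP a = evP b" using presentsD(3)[OF presP] by blast
          thus ?thesis using cr * by simp
        qed (use cr in simp)
      qed
    qed (use that(2) in simp)
    thus "(p, q) \<in> \<sigma>" using in_H by (simp add: \<sigma>_def)
  qed
  from presentsD(4)[OF presA cong this assms(1-3)]
  have "cls (p \<cdot>\<^bsub>free_act S X\<^esub> E j n k) = cls (q \<cdot>\<^bsub>free_act S X\<^esub> E j n k)"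
    using assms(4-6) by (simp add: \<sigma>_def)
  thus ?thesis by (cases p; cases q) simp
qed

lemma cls_unrow:
  assumes "a \<in> (X \<times> J) \<times> carrier M"
  shows "cls (fst (unrow i0 a), adjoin_mult (brandt_mult M) (snd (unrow i0 a)) (E i0 \<one>\<^bsub>M\<^esub> i0)) =
    (if evP a \<notin> DP then Some (evP a) else None)"
  using assms by (auto simp: cls_def)

text \<open>Right multiplication by \<open>(o, 1, o)\<close> fixes these words, so
  \<open>cls_cong\<close> compares their values of \<open>cls\<close>. The map from \<open>P\<close>
  to \<open>A\<close> is thus injective outside \<open>DP\<close>.\<close>

lemma unrow_eqD:
  assumes "a \<in> (X \<times> J) \<times> carrier M" "b \<in> (X \<times> J) \<times> carrier M"
    and "evA (unrow i0 a) = evA (unrow i0 b)"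
  shows "evP a = evP b \<or> evP a \<in> DP \<and> evP b \<in> DP"
  using cls_cong[OF unrow_in[OF assms(1)] unrow_in[OF assms(2)] assms(3) M.one_closed i0 i0]
  unfolding cls_unrow[OF assms(1)] cls_unrow[OF assms(2)] by (simp split: if_splits)

text \<open>A zero also has a representative \<open>(x, 0)\<close>, on which \<open>cls\<close> is
  \<open>None\<close> after every multiplication.\<close>

lemma unrow_zeroD:
  assumes "a \<in> (X \<times> J) \<times> carrier M" and "evA (unrow i0 a) \<star> Z = evA (unrow i0 a)"
  shows "evP a \<in> DP"
proof -
  note b = unrow_in[OF assms(1)]
  have "evA (unrow i0 a) = evA (fst (unrow i0 a), Z)"
    using evA_Z[OF b] assms(2) by simp
  moreover have "(fst (unrow i0 a), Z) \<in> X \<times> carrier S" using b by auto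
  ultimately show ?thesis
    using cls_cong[OF b _ _ M.one_closed i0 i0, of "(fst (unrow i0 a), Z)"]
    unfolding cls_unrow[OF assms(1)] by (simp add: cls_def split: if_splits)
qed

text \<open>Relations of \<open>H\<close> only mention indices from \<open>J\<close>, so outside \<open>J\<close> an irreducible generator
  behaves as in a free act: the set \<open>T\<close> below is a union of classes.\<close>

lemma irreducible_outside_J:
  assumes y: "\<not> reducible y" and x: "x \<in> X" "g x = y" and i: "i \<in> I" "i \<notin> J"
    and m: "m \<in> carrier M" and k: "k \<in> I" and q: "q \<in> X \<times> carrier S"
    and eq: "evA (x, E i m k) = evA q"
  shows "\<exists>x'\<in>X. g x' = y \<and> q = (x', E i m k)"
proof -
  interpret FX: right_act S "free_act S X" by (rule right_act_free) (rule A.monoid_axioms)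
  define T where "T = {(x', E i m k) | x'. x' \<in> X \<and> g x' = y}"
  define \<sigma> where "\<sigma> = {(p, q). p \<in> carrier (free_act S X) \<and> q \<in> carrier (free_act S X) \<and>
    (\<forall>t\<in>carrier S. (p \<cdot>\<^bsub>free_act S X\<^esub> t \<in> T) = (q \<cdot>\<^bsub>free_act S X\<^esub> t \<in> T))}"
  have cong: "act_congruence S (free_act S X) \<sigma>"
    unfolding \<sigma>_def
    using FX.act_congruence_syntactic[of "carrier S" "\<lambda>p. p \<in> T"] A.m_closed by blast
  \<comment> \<open>A side \<open>p\<close> of a relation in \<open>H\<close> that is not a free
    generator fails both conditions: its left index lies in \<open>J\<close> or it is zero, which
    bars \<open>T\<close>, and its value is reducible. So membership in \<open>T\<close> depends
    only on \<open>t\<close> and \<open>evA p\<close>, and the two sides of a relation have the same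
    value.\<close>
  have key: "p \<cdot>\<^bsub>free_act S X\<^esub> t \<in> T \<longleftrightarrow> t = E i m k \<and> evA p = y"
    if p: "p \<in> X \<times> carrier S" and idx: "idx (snd p) \<subseteq> J" and t: "t \<in> carrier S" for p t
  proof -
    obtain z s where zs: "p = (z, s)" "z \<in> X" "s \<in> carrier S" using p by (rule SigmaE)
    show ?thesis
    proof (cases s)
      case None
      thus ?thesis using zs by (auto simp: T_def act_None g_in)
    next
      case (Some b)
      hence "evA p \<noteq> y" using y zs reducible_act[of "g z" s] g_in by auto
      moreover have "p \<cdot>\<^bsub>free_act S X\<^esub> t \<notin> T"
      proof (cases b)
        case Zero
        thus ?thesis using Some zs by (cases t) (auto simp: T_def)
      next
        case (Elt i' m' k')
        hence "i' \<noteq> i" using idx i(2) zs Some by auto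
        thus ?thesis using Some Elt zs by (cases t rule: idx.cases) (auto simp: T_def)
      qed
      ultimately show ?thesis by simp
    qed
  qed
  have "H \<subseteq> \<sigma>"
  proof (rule subrelI)
    fix p q assume pq: "(p, q) \<in> H"
    note in_H = presentsD(3)[OF presA pq] and idx = idxH[OF pq]
    show "(p, q) \<in> \<sigma>"
      using key[of p] key[of q] in_H idx by (simp add: \<sigma>_def)
  qed
  hence "((x, E i m k), q) \<in> \<sigma>"
    by (rule presentsD(4)[OF presA cong]) (use x i m k q eq in auto)
  hence "\<forall>t\<in>carrier S. ((x, E i m k) \<cdot>\<^bsub>free_act S X\<^esub> t \<in> T) = (q \<cdot>\<^bsub>free_act S X\<^esub> t \<in> T)"
    unfolding \<sigma>_def by blast
  from bspec[OF this None_in]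
  have "((x, E i m k) \<cdot>\<^bsub>free_act S X\<^esub> None \<in> T) = (q \<cdot>\<^bsub>free_act S X\<^esub> None \<in> T)" .
  hence "q \<in> T" using x by (cases q) (auto simp: T_def)
  thus ?thesis by (auto simp: T_def)
qed

section \<open>A finite generating set for the kernel on F\<close>

definition W :: "('a \<times> 'i + ('x \<times> 'i) \<times> 'm) set" where
  "W = Inl ` {(y, j). y \<in> F \<and> j \<in> J \<and> row M j (w y) \<noteq> None} \<union> Inr ` D"

text \<open>\<open>Inl (y, j)\<close> indexes the row of \<open>y\<close> at \<open>j\<close>, and
  \<open>Inr d\<close> a generator of \<open>DP\<close>. Including \<open>DP\<close> lets the
  relations among the values of \<open>c\<close> detect which multiples of rows vanish in
  \<open>A\<close>.\<close>

definition c where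
  "c = case_sum (\<lambda>(y, j). evP (the (row M j (w y)))) evP"

text \<open>The four families compare the zeros of different generators, replace the identity by
  \<open>e y\<close>, make the rows absent from \<open>W\<close> vanish, and transport the relations
  \<open>G\<close> of the subact of \<open>P\<close>. Right index \<open>o\<close> suffices, since
  \<open>(o, 1, k)\<close> leads to every other \<open>k\<close>.\<close>

definition kernel_gens where
  "kernel_gens G = {((y, Z), (z, Z)) | y z. y \<in> F \<and> z \<in> F \<and> y \<star> Z = z \<star> Z} \<union>
    {((y, None), (y, e y)) | y. y \<in> F \<and> reducible y} \<union>
    {((y, E j \<one>\<^bsub>M\<^esub> i0), (y, Z)) | y j. y \<in> F \<and> j \<in> J \<and> row M j (w y) = None} \<union>
    (\<Union>pq\<in>G. lift_pair i0 pq)"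

lemma finite_W: "finite H \<Longrightarrow> finite W"
proof -
  assume "finite H"
  have "{(y, j). y \<in> F \<and> j \<in> J \<and> row M j (w y) \<noteq> None} \<subseteq> F \<times> J" by blast
  hence "finite {(y, j). y \<in> F \<and> j \<in> J \<and> row M j (w y) \<noteq> None}"
    using F(1) J(1) by (meson finite_SigmaI finite_subset)
  thus ?thesis
    unfolding W_def using finite_zero_rows[OF \<open>finite H\<close> J(1)] by (intro finite_UnI finite_imageI)
qed

lemma finite_kernel_gens:
  assumes "finite G"
  shows "finite (kernel_gens G)"
proof -
  have incl: "{((y, Z), (z, Z)) | y z. y \<in> F \<and> z \<in> F \<and> y \<star> Z = z \<star> Z} \<subseteq> (\<lambda>(y, z). ((y, Z), (z, Z))) ` (F \<times> F)"
    "{((y, None), (y, e y)) | y. y \<in> F \<and> reducible y} \<subseteq> (\<lambda>y. ((y, None), (y, e y))) ` F"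
    "{((y, E j \<one>\<^bsub>M\<^esub> i0), (y, Z)) | y j. y \<in> F \<and> j \<in> J \<and> row M j (w y) = None} \<subseteq>
      (\<lambda>(y, j). ((y, E j \<one>\<^bsub>M\<^esub> i0), (y, Z))) ` (F \<times> J)"
    by force+
  show ?thesis
    unfolding kernel_gens_def
  proof (intro finite_UnI)
    show "finite (\<Union>pq\<in>G. lift_pair i0 pq)" using assms by simp
  qed (rule finite_subset[OF incl(1)] finite_subset[OF incl(2)] finite_subset[OF incl(3)],
      use F(1) J(1) in simp)+
qed

lemma W_InlD: "Inl (y, j) \<in> W \<Longrightarrow> \<exists>b. y \<in> F \<and> j \<in> J \<and> row M j (w y) = Some b"
  by (auto simp: W_def simp del: split_paired_Ex)

lemma row_w_in:
  assumes "y \<in> F" "j \<in> J" "row M j (w y) = Some b"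
  shows "b \<in> (X \<times> J) \<times> carrier M"
  by (rule row_in[where I = I, OF M.monoid_axioms _ _ assms(2,3)]) (use w[OF assms(1)] in simp_all)

text \<open>The row of \<open>w y\<close> at \<open>j\<close>, multiplied by \<open>n\<close>, is a
  word \<open>a\<close> over \<open>X \<times> J\<close> that evaluates correctly both in
  \<open>P\<close> and, through \<open>unrow\<close>, in \<open>A\<close>. Questions about
  \<open>y (j, n, o)\<close> become questions about \<open>evP a\<close>.\<close>

lemma W_Inl:
  assumes "Inl (y, j) \<in> W" "n \<in> carrier M"
  obtains a where "y \<in> F" "j \<in> J" "a \<in> (X \<times> J) \<times> carrier M" "ev P c (Inl (y, j), n) = evP a"
    "y \<star> E j n i0 = evA (unrow i0 a)"
proof -
  obtain b where b: "y \<in> F" "j \<in> J" "row M j (w y) = Some b"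
    using W_InlD[OF assms(1)] by (elim exE conjE)
  note wy = w[OF b(1)] and b_in = row_w_in[OF b]
  let ?a = "(fst b, snd b \<otimes>\<^bsub>M\<^esub> n)"
  have "?a \<in> (X \<times> J) \<times> carrier M" using b_in assms(2) by (simp add: mem_Times_iff)
  moreover have "ev P c (Inl (y, j), n) = evP ?a"
    using P.ev_act[OF presentsD(1)[OF presP] b_in assms(2)] b(3)
    by (cases b) (simp add: c_def)
  moreover have "y \<star> E j n i0 = evA (unrow i0 ?a)"
    using row_Some[of "w y" j b n] wy b assms(2) by simp
  ultimately show thesis by (rule that[OF b(1,2)])
qed

lemma W_Inr:
  assumes "Inr d \<in> W" "n \<in> carrier M"
  shows "ev P c (Inr d, n) \<in> DP"
  using assms DP_act[OF D_in_DP] by (auto simp: W_def c_def)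

lemma c_in: "c ` W \<subseteq> carrier P"
proof -
  have evP: "evP a \<in> carrier P" if "a \<in> (X \<times> J) \<times> carrier M" for a
    by (rule P.ev_closed[OF presentsD(1)[OF presP] that])
  have "c (Inr d) \<in> carrier P" if "Inr d \<in> W" for d
    using that evP[OF D_in] by (auto simp: W_def c_def)
  moreover have "c (Inl (y, j)) \<in> carrier P" if W: "Inl (y, j) \<in> W" for y j
  proof -
    obtain b where b: "y \<in> F" "j \<in> J" "row M j (w y) = Some b"
      using W_InlD[OF W] by (elim exE conjE)
    show ?thesis using evP[OF row_w_in[OF b]] b(3) by (simp add: c_def)
  qed
  ultimately show ?thesis by (metis image_subsetI old.sum.exhaust surj_pair)
qed

section \<open>The listed relations hold in A\<close>

lemma F_in: "y \<in> F \<Longrightarrow> y \<in> carrier A"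
  using F(2) by blast

lemma row_None_zero:
  assumes "y \<in> F" "j \<in> J" "row M j (w y) = None" "n \<in> carrier M" "k \<in> I"
  shows "y \<star> E j n k = y \<star> Z"
  using row_None[of "w y" j n k] evA_Z[of "w y"] w[OF assms(1)] assms by simp

lemma reducible_e:
  assumes "y \<in> F" "reducible y"
  shows "y \<star> e y = y" "e y \<in> insert Z ((\<lambda>r. E r \<one>\<^bsub>M\<^esub> r) ` J)"
proof -
  obtain s where "s \<in> insert Z ((\<lambda>r. E r \<one>\<^bsub>M\<^esub> r) ` I)" "y \<star> s = y"
    using assms(2) unfolding reducible_def by blast
  from e[OF assms(1) this]
  show "y \<star> e y = y" "e y \<in> insert Z ((\<lambda>r. E r \<one>\<^bsub>M\<^esub> r) ` J)" by blast+
qed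

lemma e_in:
  assumes "y \<in> F" "reducible y"
  shows "e y \<in> carrier S" "e y \<noteq> None"
  using reducible_e(2)[OF assms] J_in_I by auto

lemma zero_eqD:
  assumes "y \<in> F" "z \<in> F" "s \<in> carrier S" "t \<in> carrier S" "y \<star> s = z \<star> t"
  shows "y \<star> Z = z \<star> Z"
proof -
  have "y \<star> s \<star> Z = y \<star> Z" "z \<star> t \<star> Z = z \<star> Z"
    using assms(1-4) F_in by (simp_all add: act_act)
  thus ?thesis using assms(5) by simp
qed

lemma kernel_gens_ker:
  assumes presG: "presents M (P\<lparr>carrier := ev P c ` (W \<times> carrier M)\<rparr>) W c G"
  shows "kernel_gens G \<subseteq> ev_ker S A F id"
proof -
  have lift: "lift_pair i0 ((u, m), (v, n)) \<subseteq> ev_ker S A F id" if G: "((u, m), (v, n)) \<in> G" for u m v n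
  proof -
    have W: "u \<in> W" "m \<in> carrier M" "v \<in> W" "n \<in> carrier M"
      and eq: "ev P c (u, m) = ev P c (v, n)"
      using presentsD(3)[OF presG G] by auto
    \<comment> \<open>For the pairs with exactly one \<open>Inr\<close> side: that side has its
      value in \<open>DP\<close>, so the other does too.\<close>
    have one: "((y, E j m i0), (y, Z)) \<in> ev_ker S A F id"
      if y: "Inl (y, j) \<in> W" and m: "m \<in> carrier M" and D: "ev P c (Inl (y, j), m) \<in> DP" for y j m
    proof -
      obtain a where a: "y \<in> F" "j \<in> J" "a \<in> (X \<times> J) \<times> carrier M" "ev P c (Inl (y, j), m) = evP a"
          "y \<star> E j m i0 = evA (unrow i0 a)"
        using W_Inl[OF y m] by metis
      have "y \<star> E j m i0 \<star> Z = y \<star> E j m i0"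
        unfolding a(5) using D_generated_zero[OF a(3)] D a(4) by simp
      hence "y \<star> E j m i0 = y \<star> Z"
        using a(1,2) m i0 J_in_I F_in by (simp add: act_act)
      thus ?thesis using a(1,2) m i0 J_in_I by (simp add: ev_ker_def)
    qed
    show ?thesis
    proof (cases u; cases v)
      fix yi zj assume uv: "u = Inl yi" "v = Inl zj"
      obtain y i z j where yz: "yi = (y, i)" "zj = (z, j)" by (cases yi; cases zj)
      obtain a where a: "y \<in> F" "i \<in> J" "a \<in> (X \<times> J) \<times> carrier M" "ev P c (Inl (y, i), m) = evP a"
          "y \<star> E i m i0 = evA (unrow i0 a)"
        using W_Inl[of y i m] W uv yz by metis
      obtain b where b: "z \<in> F" "j \<in> J" "b \<in> (X \<times> J) \<times> carrier M" "ev P c (Inl (z, j), n) = evP b"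
          "z \<star> E j n i0 = evA (unrow i0 b)"
        using W_Inl[of z j n] W uv yz by metis
      have "y \<star> E i m i0 = z \<star> E j n i0"
        using row_rels_unrow[OF a(3) b(3)] a b eq uv yz by simp
      thus ?thesis using uv yz a(1,2) b(1,2) W i0 J_in_I by (simp add: ev_ker_def)
    next
      fix yi d assume uv: "u = Inl yi" "v = Inr d"
      obtain y i where yi: "yi = (y, i)" by (cases yi)
      have "ev P c (Inl (y, i), m) \<in> DP" using W_Inr[of d n] W uv yi eq by simp
      thus ?thesis using one[of y i m] uv yi W by simp
    next
      fix zj d assume uv: "u = Inr d" "v = Inl zj"
      obtain z j where zj: "zj = (z, j)" by (cases zj)
      have "ev P c (Inl (z, j), n) \<in> DP" using W_Inr[of d m] W uv zj eq by simp
      thus ?thesis using one[of z j n] uv zj W by simp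
    qed simp
  qed
  have "lift_pair i0 pq \<subseteq> ev_ker S A F id" if "pq \<in> G" for pq
    using that lift by (metis surj_pair)
  moreover have "((y, None), (y, e y)) \<in> ev_ker S A F id" if "y \<in> F" "reducible y" for y
    using that e_in reducible_e(1) act_None F_in by (simp add: ev_ker_def)
  moreover have "((y, E j \<one>\<^bsub>M\<^esub> i0), (y, Z)) \<in> ev_ker S A F id"
    if "y \<in> F" "j \<in> J" "row M j (w y) = None" for y j
    using row_None_zero[OF that M.one_closed i0] that i0 J_in_I by (simp add: ev_ker_def)
  moreover have "((y, Z), (z, Z)) \<in> ev_ker S A F id" if "y \<in> F" "z \<in> F" "y \<star> Z = z \<star> Z" for y z
    using that by (simp add: ev_ker_def)
  ultimately show ?thesis
    unfolding kernel_gens_def by (intro Un_least UN_least; blast)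
qed

section \<open>Products with indices outside J\<close>

lemma irreducible_generator:
  assumes "y \<in> F" "\<not> reducible y"
  obtains x where "x \<in> X" "w y = (x, None)" "g x = y"
proof -
  obtain x s where x: "w y = (x, s)" "x \<in> X" "s \<in> carrier S" "g x \<star> s = y"
    using w[OF assms(1)] by (cases "w y") simp
  \<comment> \<open>A product by anything but the identity is reducible.\<close>
  have "s = None" using reducible_act[OF g_in[OF x(2)] x(3)] x(4) assms(2) by blast
  thus thesis using that x act_None g_in by simp
qed

text \<open>\<open>e y\<close> is \<open>0\<close> or \<open>(r, 1, r)\<close> with \<open>r\<close>
  in \<open>J\<close>, so \<open>r \<noteq> i\<close>. This is why the single relation
  \<open>y = y e\<close> settles all indices outside \<open>J\<close> for a reducible
  \<open>y\<close>.\<close>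

lemma reducible_outside_J:
  assumes "y \<in> F" "reducible y" "i \<notin> J"
  shows "adjoin_mult (brandt_mult M) (e y) (E i m k) = Z"
  using reducible_e(2)[OF assms(1,2)] assms(3) by auto

text \<open>A reducible \<open>y\<close> would have \<open>y (i, m, o) = y 0\<close>. For
  irreducible \<open>y\<close>, the word of \<open>z (j, n, o)\<close> over \<open>X\<close> must be
  \<open>x' (i, m, o)\<close> with \<open>g x' = y\<close>, by
  \<open>irreducible_outside_J\<close>.\<close>

lemma nonzero_outside_J:
  assumes y: "y \<in> F" and z: "z \<in> F" and i: "i \<in> I" "i \<notin> J" and j: "j \<in> I"
    and m: "m \<in> carrier M" and n: "n \<in> carrier M"
    and eq: "y \<star> E i m i0 = z \<star> E j n i0" and nz: "y \<star> E i m i0 \<noteq> y \<star> Z"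
  shows "y = z \<and> i = j \<and> m = n"
proof -
  have irr: "\<not> reducible y"
  proof
    assume red: "reducible y"
    have "y \<star> e y \<star> E i m i0 = y \<star> Z"
      using reducible_outside_J[OF y red i(2)] e_in[OF y red] y i m i0 F_in by (simp add: act_act)
    thus False using nz reducible_e(1)[OF y red] by simp
  qed
  obtain x where x: "x \<in> X" "w y = (x, None)" "g x = y"
    using irreducible_generator[OF y irr] by blast
  obtain x'' t where wz: "w z = (x'', t)" "x'' \<in> X" "t \<in> carrier S" "g x'' \<star> t = z" "idx t \<subseteq> J"
    using w[OF z] by (cases "w z") simp
  let ?t = "adjoin_mult (brandt_mult M) t (E j n i0)"
  have t: "?t \<in> carrier S" using A.m_closed[of t "E j n i0"] wz(3) j n i0 by simp
  have "g x'' \<star> t \<star> E j n i0 = g x'' \<star> ?t"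
    by (rule act_act) (use g_in[OF wz(2)] wz(3) j n i0 in simp_all)
  hence ev_eq: "evA (x, E i m i0) = evA (x'', ?t)" using eq x wz(4) by simp
  have in_XS: "(x'', ?t) \<in> X \<times> carrier S" using wz(2) t by simp
  obtain x' where x': "x' \<in> X" "g x' = y" "x'' = x'" "?t = E i m i0"
    using irreducible_outside_J[OF irr x(1,3) i m i0 in_XS ev_eq] by blast
  from wz(3) show ?thesis
  proof (cases rule: S_cases)
    case 1
    thus ?thesis using x' wz(4) act_None g_in by auto
  next
    \<comment> \<open>Here the product has left index \<open>a\<close> in \<open>J\<close> or is
      zero, so it cannot be \<open>(i, m, o)\<close>.\<close>
    case (3 a b k)
    thus ?thesis using x'(4) wz(5) i(2) by (auto split: if_splits)
  qed (use x'(4) in simp)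
qed

section \<open>Arbitrary congruences containing the listed relations\<close>

context
  fixes G \<sigma>
  assumes presG: "presents M (P\<lparr>carrier := ev P c ` (W \<times> carrier M)\<rparr>) W c G"
    and \<sigma>: "act_congruence S (free_act S F) \<sigma>" and gens: "kernel_gens G \<subseteq> \<sigma>"
begin

lemma \<sigma>_act:
  assumes "((y, s), (z, t)) \<in> \<sigma>" "r \<in> carrier S"
  shows "((y, adjoin_mult (brandt_mult M) s r), (z, adjoin_mult (brandt_mult M) t r)) \<in> \<sigma>"
  using act_congruence_act[OF \<sigma> assms] by simp

lemmas \<sigma>_sym = act_congruence_sym[OF \<sigma>]

lemmas \<sigma>_trans = act_congruence_trans[OF \<sigma>]

lemma \<sigma>_refl: "y \<in> F \<Longrightarrow> s \<in> carrier S \<Longrightarrow> ((y, s), (y, s)) \<in> \<sigma>"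
  using act_congruence_refl[OF \<sigma>] by simp

lemma gen_zero: "y \<in> F \<Longrightarrow> z \<in> F \<Longrightarrow> y \<star> Z = z \<star> Z \<Longrightarrow> ((y, Z), (z, Z)) \<in> \<sigma>"
  and gen_e: "y \<in> F \<Longrightarrow> reducible y \<Longrightarrow> ((y, None), (y, e y)) \<in> \<sigma>"
  and gen_row: "y \<in> F \<Longrightarrow> j \<in> J \<Longrightarrow> row M j (w y) = None \<Longrightarrow> ((y, E j \<one>\<^bsub>M\<^esub> i0), (y, Z)) \<in> \<sigma>"
  and gen_lift: "pq \<in> G \<Longrightarrow> lift_pair i0 pq \<subseteq> \<sigma>"
  using gens unfolding kernel_gens_def by blast+

text \<open>Vanishing modulo \<open>\<sigma>\<close>. \<open>Inr\<close> words have no counterpart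
  over \<open>F\<close>; they represent elements of \<open>DP\<close> and count as zero.\<close>

definition zero_word where
  "zero_word p \<longleftrightarrow> (case fst p of Inl (y, i) \<Rightarrow> ((y, E i (snd p) i0), (y, Z)) \<in> \<sigma> | Inr d \<Rightarrow> True)"

text \<open>The trace of \<open>\<sigma>\<close> on words over \<open>W\<close>. Zero words are all
  related, even those of different \<open>y\<close> whose zeros \<open>\<sigma>\<close> may
  separate; this gives \<open>Inr\<close> words a place and collapses \<open>DP\<close>. As
  \<open>\<tau>\<close> contains \<open>G\<close>, words with equal values in \<open>P\<close> are
  related by \<open>\<tau>\<close>.\<close>

definition \<tau> where
  "\<tau> = {(p, q). p \<in> W \<times> carrier M \<and> q \<in> W \<times> carrier M \<and> (zero_word p \<and> zero_word q \<or>
    (\<exists>y i m z j n. p = (Inl (y, i), m) \<and> q = (Inl (z, j), n) \<and> ((y, E i m i0), (z, E j n i0)) \<in> \<sigma>))}"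

text \<open>Acting by \<open>0\<close> relates \<open>y 0\<close> to \<open>z 0\<close>, so
  vanishing spreads along \<open>\<sigma>\<close>. This makes the two alternatives in
  \<open>\<tau>\<close> compatible, hence \<open>\<tau>\<close> transitive.\<close>

lemma zero_word_cong:
  assumes "((y, E i m i0), (z, E j n i0)) \<in> \<sigma>" "zero_word (Inl (y, i), m)"
  shows "zero_word (Inl (z, j), n)"
proof -
  have yz: "((y, E i m i0), (y, Z)) \<in> \<sigma>" using assms(2) by (simp add: zero_word_def)
  have "((y, Z), (z, Z)) \<in> \<sigma>" using \<sigma>_act[OF assms(1) Z_in] by simp
  from \<sigma>_trans[OF \<sigma>_trans[OF \<sigma>_sym[OF assms(1)] yz] this]
  show ?thesis by (simp add: zero_word_def)
qed

lemma zero_word_act: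
  assumes "zero_word (u, m)" "n \<in> carrier M"
  shows "zero_word (u, m \<otimes>\<^bsub>M\<^esub> n)"
proof (cases u)
  case (Inl yi)
  obtain y i where yi: "yi = (y, i)" by (cases yi)
  have "((y, E i m i0), (y, Z)) \<in> \<sigma>" using assms(1) Inl yi by (simp add: zero_word_def)
  from \<sigma>_act[OF this, of "E i0 n i0"] show ?thesis
    using assms(2) i0 Inl yi by (simp add: zero_word_def)
qed (simp add: zero_word_def)

lemma W_in_F: "Inl (y, j) \<in> W \<Longrightarrow> y \<in> F \<and> j \<in> J"
  by (auto simp: W_def)

lemma \<tau>_congruence: "act_congruence M (free_act M W) \<tau>"
proof (rule act_congruenceI)
  fix p q r s
  show "\<tau> \<subseteq> carrier (free_act M W) \<times> carrier (free_act M W)" by (auto simp: \<tau>_def)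
  show "(p, p) \<in> \<tau>" if p: "p \<in> carrier (free_act M W)"
  proof (cases "fst p")
    case (Inl yi)
    obtain y i m where y: "p = (Inl (y, i), m)" using Inl by (cases p; cases yi) simp
    hence "y \<in> F" "i \<in> I" "m \<in> carrier M" using p W_in_F J_in_I by auto
    thus ?thesis using p y \<sigma>_refl[of y "E i m i0"] i0 by (simp add: \<tau>_def)
  next
    case (Inr d)
    thus ?thesis using p by (simp add: \<tau>_def zero_word_def)
  qed
  show "(q, p) \<in> \<tau>" if "(p, q) \<in> \<tau>"
    using that \<sigma>_sym unfolding \<tau>_def by blast
  show "(p, r) \<in> \<tau>" if pq: "(p, q) \<in> \<tau>" and qr: "(q, r) \<in> \<tau>"
  proof (cases "zero_word q")
    case True
    have "zero_word p" using pq True zero_word_cong \<sigma>_sym unfolding \<tau>_def by blast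
    moreover have "zero_word r" using qr True zero_word_cong unfolding \<tau>_def by blast
    ultimately show ?thesis using pq qr unfolding \<tau>_def by blast
  next
    case False
    then obtain y i m z j n where 1: "p = (Inl (y, i), m)" "q = (Inl (z, j), n)"
      "((y, E i m i0), (z, E j n i0)) \<in> \<sigma>" using pq unfolding \<tau>_def by blast
    obtain v k l where 2: "r = (Inl (v, k), l)" "((z, E j n i0), (v, E k l i0)) \<in> \<sigma>"
      using qr False 1(2) unfolding \<tau>_def by blast
    from \<sigma>_trans[OF 1(3) 2(2)] show ?thesis using pq qr 1 2 by (simp add: \<tau>_def)
  qed
  show "(p \<cdot>\<^bsub>free_act M W\<^esub> s, q \<cdot>\<^bsub>free_act M W\<^esub> s) \<in> \<tau>" if pq: "(p, q) \<in> \<tau>" and s: "s \<in> carrier M"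
  proof -
    obtain u m v n where uv: "p = (u, m)" "q = (v, n)" by (cases p; cases q)
    have W: "u \<in> W" "v \<in> W" "m \<in> carrier M" "n \<in> carrier M" using pq uv by (simp_all add: \<tau>_def)
    show ?thesis
    proof (cases "zero_word p \<and> zero_word q")
      case True
      thus ?thesis using uv W s zero_word_act[of u m s] zero_word_act[of v n s] by (simp add: \<tau>_def)
    next
      case False
      then obtain y i z j where 1: "u = Inl (y, i)" "v = Inl (z, j)"
        "((y, E i m i0), (z, E j n i0)) \<in> \<sigma>" using pq uv unfolding \<tau>_def by blast
      from \<sigma>_act[OF 1(3), of "E i0 s i0"] show ?thesis
        using uv 1 W s i0 by (simp add: \<tau>_def)
    qed
  qed
qed

lemma G_\<tau>: "G \<subseteq> \<tau>"
proof (rule subrelI)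
  fix p q assume pq: "(p, q) \<in> G"
  note W = presentsD(3)[OF presG pq]
  obtain u m v n where uv: "p = (u, m)" "q = (v, n)" by (cases p; cases q)
  have lift: "lift_pair i0 ((u, m), (v, n)) \<subseteq> \<sigma>" using gen_lift pq uv by blast
  show "(p, q) \<in> \<tau>"
  proof (cases u; cases v)
    fix yi zj assume "u = Inl yi" "v = Inl zj"
    thus ?thesis using lift W uv by (cases yi; cases zj) (simp add: \<tau>_def)
  next
    fix yi d assume "u = Inl yi" "v = Inr d"
    thus ?thesis using lift W uv by (cases yi) (simp add: \<tau>_def zero_word_def)
  next
    fix zj d assume "u = Inr d" "v = Inl zj"
    thus ?thesis using lift W uv by (cases zj) (simp add: \<tau>_def zero_word_def)
  next
    fix d d' assume "u = Inr d" "v = Inr d'"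
    thus ?thesis using W uv by (simp add: \<tau>_def zero_word_def)
  qed
qed

lemma ker_\<tau>:
  assumes "p \<in> W \<times> carrier M" "q \<in> W \<times> carrier M" "ev P c p = ev P c q"
  shows "(p, q) \<in> \<tau>"
  by (rule presentsD(4)[OF presG \<tau>_congruence G_\<tau> assms(1,2)]) (use assms(3) in simp)

lemma in_W: "y \<in> F \<Longrightarrow> j \<in> J \<Longrightarrow> row M j (w y) \<noteq> None \<Longrightarrow> Inl (y, j) \<in> W"
  by (simp add: W_def)

text \<open>Outside \<open>J\<close>, a reducible \<open>y\<close> is settled by
  \<open>y = y e\<close>, and an irreducible one cannot satisfy the equation. Inside
  \<open>J\<close>, either the row is literally zero, or its multiple by \<open>m\<close> has its
  value in \<open>DP\<close>, which is also the value of an \<open>Inr\<close> word.\<close>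

lemma zero_related_i0:
  assumes y: "y \<in> F" and i: "i \<in> I" and m: "m \<in> carrier M" and eq: "y \<star> E i m i0 = y \<star> Z"
  shows "((y, E i m i0), (y, Z)) \<in> \<sigma>"
proof (cases "i \<in> J")
  case False
  show ?thesis
  proof (cases "reducible y")
    case True
    from \<sigma>_act[OF gen_e[OF y True], of "E i m i0"]
    show ?thesis using reducible_outside_J[OF y True False] i m i0 by simp
  next
    case irr: False
    obtain x where x: "x \<in> X" "w y = (x, None)" "g x = y"
      using irreducible_generator[OF y irr] by blast
    have "evA (x, E i m i0) = evA (x, Z)" using eq x by simp
    \<comment> \<open>The conclusion would equate \<open>0\<close> with
      \<open>(i, m, o)\<close>.\<close>
    from irreducible_outside_J[OF irr x(1,3) i False m i0 _ this] x(1)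
    show ?thesis by simp
  qed
next
  case True
  show ?thesis
  proof (cases "row M i (w y) = None")
    case None: True
    from \<sigma>_act[OF gen_row[OF y True None], of "E i0 m i0"]
    show ?thesis using i m i0 by simp
  next
    case False
    note yW = in_W[OF y True False]
    obtain a where a: "a \<in> (X \<times> J) \<times> carrier M" "ev P c (Inl (y, i), m) = evP a"
      "y \<star> E i m i0 = evA (unrow i0 a)"
      using W_Inl[OF yW m] by metis
    have "y \<star> E i m i0 \<star> Z = y \<star> E i m i0" using eq F_in[OF y] by (simp add: act_act)
    hence "evP a \<in> DP" using unrow_zeroD[OF a(1)] a(3) by simp
    then obtain p where p: "evP a = ev P evP p" "p \<in> D \<times> carrier M"
      unfolding DP_def by (rule imageE)
    obtain d n where dn: "p = (d, n)" and d: "d \<in> D" "n \<in> carrier M" using p(2) by (rule SigmaE)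
    have "ev P c (Inl (y, i), m) = ev P c (Inr d, n)"
      using a(2) p(1) dn by (simp add: c_def)
    moreover have "Inr d \<in> W" using d(1) by (simp add: W_def)
    ultimately have "((Inl (y, i), m), (Inr d, n)) \<in> \<tau>"
      using yW m d(2) by (intro ker_\<tau>) simp_all
    thus ?thesis by (simp add: \<tau>_def zero_word_def)
  qed
qed

text \<open>Multiplying by \<open>(k, 1, o)\<close> moves the equation to right index
  \<open>o\<close>, and \<open>(o, 1, k)\<close> moves the resulting pair back.\<close>

lemma zero_related:
  assumes y: "y \<in> F" and s: "s \<in> carrier S" "s \<noteq> None" and eq: "y \<star> s = y \<star> Z"
  shows "((y, s), (y, Z)) \<in> \<sigma>"
  using s(1)
proof (cases rule: S_cases)
  case 2
  thus ?thesis using \<sigma>_refl[OF y Z_in] by simp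
next
  case (3 i m k)
  have "y \<star> s \<star> E k \<one>\<^bsub>M\<^esub> i0 = y \<star> Z \<star> E k \<one>\<^bsub>M\<^esub> i0" using eq by simp
  hence "y \<star> E i m i0 = y \<star> Z" using 3 i0 F_in[OF y] by (simp add: act_act)
  from \<sigma>_act[OF zero_related_i0[OF y 3(2,3) this], of "E i0 \<one>\<^bsub>M\<^esub> k"]
  show ?thesis using 3 i0 by simp
qed (use s(2) in simp)

text \<open>If an index lies outside \<open>J\<close>, the two words coincide. Otherwise the common
  value is no zero, so the values in \<open>P\<close> lie outside \<open>DP\<close> and are equal;
  the relations \<open>G\<close> transfer this to \<open>\<sigma>\<close>.\<close>

lemma nonzero_related_i0:
  assumes y: "y \<in> F" and z: "z \<in> F" and i: "i \<in> I" and j: "j \<in> I"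
    and m: "m \<in> carrier M" and n: "n \<in> carrier M"
    and eq: "y \<star> E i m i0 = z \<star> E j n i0" and nz: "y \<star> E i m i0 \<noteq> y \<star> Z"
  shows "((y, E i m i0), (z, E j n i0)) \<in> \<sigma>"
proof -
  have yz: "y \<star> Z = z \<star> Z" by (rule zero_eqD[OF y z _ _ eq]) (use i j m n i0 in simp_all)
  hence nz': "z \<star> E j n i0 \<noteq> z \<star> Z" using eq nz by simp
  show ?thesis
  proof (cases "i \<in> J \<and> j \<in> J")
    case False
    hence "y = z \<and> i = j \<and> m = n"
      using nonzero_outside_J[OF y z i _ j m n eq nz]
        nonzero_outside_J[OF z y j _ i n m eq[symmetric] nz'] by blast
    thus ?thesis using \<sigma>_refl[OF y, of "E i m i0"] i m i0 by simp
  next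
    case True
    have yW: "Inl (y, i) \<in> W" using in_W[OF y] row_None_zero[OF y _ _ m i0] True nz by blast
    have zW: "Inl (z, j) \<in> W" using in_W[OF z] row_None_zero[OF z _ _ n i0] True nz' by blast
    obtain a where a: "a \<in> (X \<times> J) \<times> carrier M" "ev P c (Inl (y, i), m) = evP a"
      "y \<star> E i m i0 = evA (unrow i0 a)"
      using W_Inl[OF yW m] by metis
    obtain b where b: "b \<in> (X \<times> J) \<times> carrier M" "ev P c (Inl (z, j), n) = evP b"
      "z \<star> E j n i0 = evA (unrow i0 b)"
      using W_Inl[OF zW n] by metis
    have "evP a \<notin> DP"
    proof
      assume "evP a \<in> DP"
      from D_generated_zero[OF a(1) this] have "y \<star> E i m i0 \<star> Z = y \<star> E i m i0"
        unfolding a(3) .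
      thus False using nz i m i0 F_in[OF y] by (simp add: act_act)
    qed
    hence "evP a = evP b" using unrow_eqD[OF a(1) b(1)] a(3) b(3) eq by auto
    hence "((Inl (y, i), m), (Inl (z, j), n)) \<in> \<tau>"
      using yW zW m n a(2) b(2) by (intro ker_\<tau>) simp_all
    hence "((y, E i m i0), (y, Z)) \<in> \<sigma> \<and> ((z, E j n i0), (z, Z)) \<in> \<sigma> \<or>
        ((y, E i m i0), (z, E j n i0)) \<in> \<sigma>"
      by (simp add: \<tau>_def zero_word_def)
    \<comment> \<open>\<open>\<sigma>\<close> may exceed the kernel, so both words may vanish modulo
      \<open>\<sigma>\<close>; then \<open>y 0 = z 0\<close> links them.\<close>
    thus ?thesis using \<sigma>_trans[OF _ \<sigma>_trans[OF gen_zero[OF y z yz] \<sigma>_sym]] by blast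
  qed
qed

lemma related_proper:
  assumes y: "y \<in> F" and z: "z \<in> F" and s: "s \<in> carrier S" "s \<noteq> None"
    and t: "t \<in> carrier S" "t \<noteq> None" and eq: "y \<star> s = z \<star> t"
  shows "((y, s), (z, t)) \<in> \<sigma>"
proof -
  note yz = zero_eqD[OF y z s(1) t(1) eq]
  show ?thesis
  proof (cases "y \<star> s = y \<star> Z")
    case True
    hence "((y, s), (y, Z)) \<in> \<sigma>" by (rule zero_related[OF y s])
    moreover have "((z, t), (z, Z)) \<in> \<sigma>"
      by (rule zero_related[OF z t]) (use True eq yz in simp)
    ultimately show ?thesis
      using \<sigma>_trans[OF _ \<sigma>_trans[OF gen_zero[OF y z yz] \<sigma>_sym]] by blast
  next
    case False
    obtain i m k where s': "s = E i m k" "i \<in> I" "m \<in> carrier M" "k \<in> I"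
      using s(1) by (cases rule: S_cases) (use s(2) False in auto)
    obtain j n l where t': "t = E j n l" "j \<in> I" "n \<in> carrier M" "l \<in> I"
      using t(1) by (cases rule: S_cases) (use t(2) False eq yz in auto)
    \<comment> \<open>\<open>(k, 1, k)\<close> fixes the left side and would send the right side to
      zero.\<close>
    have "k = l"
    proof (rule ccontr)
      assume "k \<noteq> l"
      have "y \<star> s \<star> E k \<one>\<^bsub>M\<^esub> k = z \<star> t \<star> E k \<one>\<^bsub>M\<^esub> k" using eq by simp
      hence "y \<star> s = z \<star> Z" using s' t' \<open>k \<noteq> l\<close> F_in y z by (simp add: act_act)
      thus False using False yz by simp
    qed
    have "y \<star> s \<star> E k \<one>\<^bsub>M\<^esub> i0 = z \<star> t \<star> E k \<one>\<^bsub>M\<^esub> i0" using eq by simp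
    hence eq0: "y \<star> E i m i0 = z \<star> E j n i0"
      using s' t' \<open>k = l\<close> i0 F_in y z by (simp add: act_act)
    have nz: "y \<star> E i m i0 \<noteq> y \<star> Z"
    proof
      assume "y \<star> E i m i0 = y \<star> Z"
      hence "y \<star> E i m i0 \<star> E i0 \<one>\<^bsub>M\<^esub> k = y \<star> Z \<star> E i0 \<one>\<^bsub>M\<^esub> k" by simp
      thus False using False s' i0 F_in y by (simp add: act_act)
    qed
    from \<sigma>_act[OF nonzero_related_i0[OF y z s'(2) t'(2) s'(3) t'(3) eq0 nz], of "E i0 \<one>\<^bsub>M\<^esub> k"]
    show ?thesis using s' t' \<open>k = l\<close> i0 by simp
  qed
qed

text \<open>Only the identity has to be replaced, and \<open>e y\<close> does this by the relation
  \<open>y = y e\<close>.\<close>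

lemma proper_representative:
  assumes "y \<in> F" "s \<in> carrier S" "reducible (y \<star> s)"
  obtains s' where "s' \<in> carrier S" "s' \<noteq> None" "y \<star> s' = y \<star> s" "((y, s), (y, s')) \<in> \<sigma>"
proof (cases "s = None")
  case True
  hence "reducible y" using assms act_None F_in by simp
  thus thesis
    using that[of "e y"] e_in[OF assms(1)] reducible_e(1)[OF assms(1)] gen_e[OF assms(1)] True
      act_None[OF F_in[OF assms(1)]] by simp
next
  case False
  thus thesis using that[of s] assms \<sigma>_refl by simp
qed

lemma related:
  assumes y: "y \<in> F" and z: "z \<in> F" and s: "s \<in> carrier S" and t: "t \<in> carrier S"
    and eq: "y \<star> s = z \<star> t"
  shows "((y, s), (z, t)) \<in> \<sigma>"
proof (cases "s = None \<and> t = None")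
  case True
  hence "y = z" using eq act_None F_in y z by simp
  thus ?thesis using True \<sigma>_refl[OF y s] by simp
next
  case False
  \<comment> \<open>A factor other than the identity on either side makes the common value
    reducible, so an identity on the other side can be replaced.\<close>
  hence red: "reducible (y \<star> s)"
    using reducible_act[OF F_in[OF y] s] reducible_act[OF F_in[OF z] t] eq by auto
  obtain s' where s': "s' \<in> carrier S" "s' \<noteq> None" "y \<star> s' = y \<star> s" "((y, s), (y, s')) \<in> \<sigma>"
    using proper_representative[OF y s red] .
  obtain t' where t': "t' \<in> carrier S" "t' \<noteq> None" "z \<star> t' = z \<star> t" "((z, t), (z, t')) \<in> \<sigma>"
    using proper_representative[OF z t] red eq by metis
  have "((y, s'), (z, t')) \<in> \<sigma>"
    by (rule related_proper[OF y z s'(1,2) t'(1,2)]) (simp add: s'(3) t'(3) eq)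
  from \<sigma>_trans[OF s'(4) \<sigma>_trans[OF this \<sigma>_sym[OF t'(4)]]] show ?thesis .
qed

end

lemma kernel_finitely_generated:
  assumes coh: "right_coherent M" and fin: "finite X" "finite H"
  shows "\<exists>G. finite G \<and> G \<subseteq> ev_ker S A F id \<and>
    (\<forall>\<sigma>. act_congruence S (free_act S F) \<sigma> \<and> G \<subseteq> \<sigma> \<longrightarrow> ev_ker S A F id \<subseteq> \<sigma>)"
proof -
  have "finite (X \<times> J)" using fin(1) J(1) by simp
  hence "fin_pres M P"
    by (rule presents_imp_fin_pres[OF P.right_act_axioms presP _ finite_row_rels[OF fin(2) J(1)]])
  then obtain G where G: "finite G" "presents M (P\<lparr>carrier := ev P c ` (W \<times> carrier M)\<rparr>) W c G"
    using right_coherent_presents[OF coh P.right_act_axioms _ finite_W[OF fin(2)] c_in] by metis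
  show ?thesis
  proof (intro exI[of _ "kernel_gens G"] conjI allI impI subrelI)
    show "finite (kernel_gens G)" by (rule finite_kernel_gens[OF G(1)])
    show "(p, q) \<in> ev_ker S A F id" if "(p, q) \<in> kernel_gens G" for p q
      using that kernel_gens_ker[OF G(2)] by blast
    fix \<sigma> p q assume \<sigma>: "act_congruence S (free_act S F) \<sigma> \<and> kernel_gens G \<subseteq> \<sigma>"
      and pq: "(p, q) \<in> ev_ker S A F id"
    obtain y s z t where yz: "p = (y, s)" "q = (z, t)" by (cases p; cases q)
    show "(p, q) \<in> \<sigma>"
      using related[OF G(2) conjunct1[OF \<sigma>] conjunct2[OF \<sigma>], of y z s t] pq yz
      by (simp add: ev_ker_def)
  qed
qed

end

section \<open>Choice of the index set and conclusion\<close>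

lemma finite_idx [simp]: "finite (idx s)"
  by (cases s rule: idx.cases) auto

lemma idx_subset: "s \<in> carrier (brandt_monoid M I) \<Longrightarrow> idx s \<subseteq> I"
  by (auto simp: carrier_brandt_monoid)

theorem theorem5p1:
  fixes M :: "('m, 'k) monoid_scheme" and I :: "'i set"
  assumes "monoid M" and "right_coherent M" and "I \<noteq> {}"
  shows "right_coherent (brandt_monoid M I)"
proof (rule right_coherentI)
  fix A :: "(('i, 'm) brandt option, (nat \<times> ('i, 'm) brandt option) set) act" and X :: "nat set" and g H F
  let ?S = "brandt_monoid M I"
  assume A: "right_act ?S A" and X: "finite X" and H: "finite H" and pres: "presents ?S A X g H"
    and F: "finite F" "F \<subseteq> carrier A"
  obtain i0 where i0: "i0 \<in> I" using assms(3) by blast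
  have "\<exists>p. p \<in> X \<times> carrier ?S \<and> ev A g p = y" if "y \<in> F" for y
  proof -
    have "y \<in> ev A g ` (X \<times> carrier ?S)" using that F(2) presentsD(2)[OF pres] by blast
    thus ?thesis by (elim imageE) metis
  qed
  then obtain w where w: "\<And>y. y \<in> F \<Longrightarrow> w y \<in> X \<times> carrier ?S \<and> ev A g (w y) = y"
    by metis
  let ?idem = "\<lambda>J. insert (Some Zero) ((\<lambda>r. Some (Elt r \<one>\<^bsub>M\<^esub> r)) ` J)"
  \<comment> \<open>For a reducible \<open>y\<close> the choice is made among all indices of
    \<open>I\<close>; \<open>J\<close> is defined afterwards so as to contain the chosen
    one.\<close>
  define e where "e y = (SOME s. s \<in> ?idem I \<and> y \<cdot>\<^bsub>A\<^esub> s = y)" for y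
  have e: "e y \<in> ?idem I \<and> y \<cdot>\<^bsub>A\<^esub> e y = y" if "s \<in> ?idem I" "y \<cdot>\<^bsub>A\<^esub> s = y" for y s
    unfolding e_def by (rule someI[of _ s]) (use that in blast)
  \<comment> \<open>The intersection keeps \<open>J\<close> inside \<open>I\<close>: for irreducible
    \<open>y\<close> the value \<open>e y\<close> is arbitrary and its indices may lie outside
    \<open>I\<close>.\<close>
  define J where "J = I \<inter> ((\<Union>pq\<in>H. idx (snd (fst pq)) \<union> idx (snd (snd pq))) \<union>
    (\<Union>y\<in>F. idx (snd (w y)) \<union> idx (e y)))"
  have J: "finite J" "J \<subseteq> I" using H F(1) by (auto simp: J_def)
  have idxH: "idx (snd p) \<subseteq> J \<and> idx (snd q) \<subseteq> J" if pq: "(p, q) \<in> H" for p q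
  proof -
    have "snd p \<in> carrier ?S" "snd q \<in> carrier ?S"
      using presentsD(3)[OF pres pq] by (simp_all add: mem_Times_iff)
    note idx_subset[OF this(1)] idx_subset[OF this(2)]
    moreover have "idx (snd p) \<union> idx (snd q) \<subseteq> (\<Union>pq\<in>H. idx (snd (fst pq)) \<union> idx (snd (snd pq)))"
      by (rule order_trans[OF _ UN_upper[OF pq]]) simp
    ultimately show ?thesis unfolding J_def by blast
  qed
  have wJ: "idx (snd (w y)) \<subseteq> J" if y: "y \<in> F" for y
  proof -
    have "snd (w y) \<in> carrier ?S" using w[OF y] by (simp add: mem_Times_iff)
    from idx_subset[OF this] show ?thesis using y unfolding J_def by blast
  qed
  have eJ: "e y \<in> ?idem J" if y: "y \<in> F" and ey: "e y \<in> ?idem I" for y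
  proof (cases "e y = Some Zero")
    case False
    then obtain r where r: "r \<in> I" "e y = Some (Elt r \<one>\<^bsub>M\<^esub> r)" using ey by blast
    hence "r \<in> idx (e y)" by simp
    hence "r \<in> J" using y r(1) unfolding J_def by blast
    thus ?thesis using r(2) by blast
  qed simp
  have rels: "row_rels M J H \<subseteq> ((X \<times> J) \<times> carrier M) \<times> ((X \<times> J) \<times> carrier M)"
  proof (rule subrelI)
    fix a b assume "(a, b) \<in> row_rels M J H"
    then obtain p q j where pq: "(p, q) \<in> H" "j \<in> J" "row M j p = Some a" "row M j q = Some b"
      unfolding row_rels_def by blast
    show "(a, b) \<in> ((X \<times> J) \<times> carrier M) \<times> ((X \<times> J) \<times> carrier M)"
      using row_in[OF assms(1) _ _ pq(2,3)] row_in[OF assms(1) _ _ pq(2,4)]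
        presentsD(3)[OF pres pq(1)] idxH[OF pq(1)] by (intro SigmaI) blast+
  qed
  obtain P :: "('m, ((nat \<times> 'i) \<times> 'm) set) act" and gP
    where P: "right_act M P" "presents M P (X \<times> J) gP (row_rels M J H)"
    by (rule exists_presented_act[OF assms(1) rels])
  interpret brandt_presentation M I A P i0 X g H F w e J gP
  proof (intro brandt_presentation.intro brandt_presentation_axioms.intro)
    fix y assume y: "y \<in> F"
    show "w y \<in> X \<times> carrier ?S \<and> ev A g (w y) = y \<and> idx (snd (w y)) \<subseteq> J"
      using w[OF y] wJ[OF y] by simp
    fix s assume "s \<in> ?idem I" "y \<cdot>\<^bsub>A\<^esub> s = y"
    from e[OF this] show "e y \<in> ?idem J \<and> y \<cdot>\<^bsub>A\<^esub> e y = y" using eJ[OF y] by simp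
  next
    show "idx (snd p) \<subseteq> J \<and> idx (snd q) \<subseteq> J" if "(p, q) \<in> H" for p q
      by (rule idxH[OF that])
  qed (rule assms(1) A P i0 J pres F)+
  show "\<exists>G. finite G \<and> G \<subseteq> ev_ker ?S A F id \<and>
      (\<forall>\<sigma>. act_congruence ?S (free_act ?S F) \<sigma> \<and> G \<subseteq> \<sigma> \<longrightarrow> ev_ker ?S A F id \<subseteq> \<sigma>)"
    by (rule kernel_finitely_generated[OF assms(2) X H])
qed

end
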